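(* Let $\theta$ be a primitive, length $r$ substitution, of height one, and such that $(X_\theta,\sigma)$ is infinite. If $\kappa:\mathrm{Aut}(X_\theta,\sigma)\to\mathbb Z_r$ is injective (in particular if $\theta$ has a coincidence), then $\mathrm{Aut}(\bar X_\theta,\bar\sigma)=\{\mathrm{Id}\}$.
   Context: $\mathcal A$ is a finite alphabet. A substitution of length $r$ is a map $\theta:\mathcal A\to\mathcal A^r$, extended by concatenation to finite and infinite words; write $\theta(a)=\theta_0(a)\cdots\theta_{r-1}(a)$, so each $\theta_i:\mathcal A\to\mathcal A$. $\theta$ is primitive if for some $k$, every letter occurs in $\theta^k(a)$ for every letter $a$. $\bar X_\theta\subset\mathcal A^{\mathbb N_0}$ is the one-sided shift-orbit closure of any one-sided $\theta$-periodic point, with shift map $\bar\sigma$; $X_\theta\subset\mathcal A^{\mathbb Z}$ is the corresponding two-sided shift (all bi-infinite sequences whose finite subwords all occur in points of $\bar X_\theta$), with shift map $\sigma$. $\mathrm{Aut}$ of a shift is the group of its self-homeomorphisms commuting with the shift. Height: with $u=u_0u_1\ldots$ a fixed point of $\theta$ (or of a power of $\theta$), $h(\theta)=\max\{n\ge1:\gcd(n,r)=1,\ n\mid\gcd\{a:u_a=u_0\}\}$. $\theta$ (of height one) has a coincidence if $|\theta_{i_1}\circ\cdots\circ\theta_{i_k}(\mathcal A)|=1$ for some $k\ge1$ and some $i_1,\ldots,i_k\in\{0,\ldots,r-1\}$. $\mathbb Z_r$ is the additive group of $r$-adic integers ($r$ not necessarily prime). For $\theta$ as in the statement the maximal equicontinuous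 factor of $(X_\theta,\sigma)$ is $(\mathbb Z_r,+1)$; let $\pi:X_\theta\to\mathbb Z_r$ be the factor map. For $\Phi\in\mathrm{Aut}(X_\theta,\sigma)$, $\kappa(\Phi)\in\mathbb Z_r$ is the unique element with $\pi(\Phi(x))=\kappa(\Phi)+\pi(x)$ for all $x\in X_\theta$. *)

theory Defs
  imports "HOL-Analysis.Analysis"
begin

text \<open>
  The alphabet is a type of class \<open>finite\<close> with the discrete topology, and sequence
  spaces such as \<open>nat \<Rightarrow> 'a\<close> and \<open>int \<Rightarrow> 'a\<close> carry the product topology of
  \<open>HOL-Analysis\<close>.  Subsets of them carry the subspace topology.
\<close>

section \<open>Substitutions of constant length\<close>

definition substitution_of_length :: "nat \<Rightarrow> ('a \<Rightarrow> 'a list) \<Rightarrow> bool" where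
  "substitution_of_length r \<theta> \<longleftrightarrow> (\<forall>a. length (\<theta> a) = r)"

definition subst_word :: "('a \<Rightarrow> 'a list) \<Rightarrow> 'a list \<Rightarrow> 'a list" where
  "subst_word \<theta> w = concat (map \<theta> w)"

text \<open>For a substitution of length \<open>r\<close>, the letter at position \<open>n\<close> of the concatenation
  \<open>\<theta> (u 0) @ \<theta> (u 1) @ \<dots>\<close> lies in the block \<open>n div r\<close> at offset \<open>n mod r\<close>.\<close>

definition subst_seq :: "nat \<Rightarrow> ('a \<Rightarrow> 'a list) \<Rightarrow> (nat \<Rightarrow> 'a) \<Rightarrow> nat \<Rightarrow> 'a" where
  "subst_seq r \<theta> u = (\<lambda>n. \<theta> (u (n div r)) ! (n mod r))"

definition primitive :: "('a \<Rightarrow> 'a list) \<Rightarrow> bool" where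
  "primitive \<theta> \<longleftrightarrow> (\<exists>k\<ge>1. \<forall>a b. b \<in> set ((subst_word \<theta> ^^ k) [a]))"

definition periodic_point :: "nat \<Rightarrow> ('a \<Rightarrow> 'a list) \<Rightarrow> (nat \<Rightarrow> 'a) \<Rightarrow> bool" where
  "periodic_point r \<theta> u \<longleftrightarrow> (\<exists>k\<ge>1. (subst_seq r \<theta> ^^ k) u = u)"

definition height :: "nat \<Rightarrow> (nat \<Rightarrow> 'a) \<Rightarrow> nat" where
  "height r u = Max {n. n \<ge> 1 \<and> coprime n r \<and> n dvd Gcd {a. u a = u 0}}"

definition column :: "('a \<Rightarrow> 'a list) \<Rightarrow> nat \<Rightarrow> 'a \<Rightarrow> 'a" where
  "column \<theta> i a = \<theta> a ! i"

definition has_coincidence :: "nat \<Rightarrow> ('a \<Rightarrow> 'a list) \<Rightarrow> bool" where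
  "has_coincidence r \<theta> \<longleftrightarrow>
     (\<exists>is. is \<noteq> [] \<and> set is \<subseteq> {..<r} \<and>
        card (range (foldr (\<lambda>i g. column \<theta> i \<circ> g) is id)) = 1)"

section \<open>The associated shifts\<close>

definition shift :: "('i::{one,plus} \<Rightarrow> 'a) \<Rightarrow> 'i \<Rightarrow> 'a" where
  "shift x = (\<lambda>n. x (n + 1))"

text \<open>The shifts of a substitution are obtained by taking \<open>u\<close> to be one of its periodic points.
  For a primitive substitution they do not depend on which one.\<close>

definition one_sided_shift :: "(nat \<Rightarrow> 'a::discrete_topology) \<Rightarrow> (nat \<Rightarrow> 'a) set" where
  "one_sided_shift u = closure (range (\<lambda>n. (shift ^^ n) u))"

definition two_sided_shift :: "(nat \<Rightarrow> 'a::discrete_topology) \<Rightarrow> (int \<Rightarrow> 'a) set" where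
  "two_sided_shift u =
     {x. \<forall>i n. \<exists>y\<in>one_sided_shift u. \<exists>j. \<forall>k<n. x (i + int k) = y (j + k)}"

text \<open>Automorphisms of \<open>(X, S)\<close> are represented by functions that are \<open>undefined\<close> outside \<open>X\<close>,
  so that equality of functions is equality on \<open>X\<close>.\<close>

definition Aut :: "'x::topological_space set \<Rightarrow> ('x \<Rightarrow> 'x) \<Rightarrow> ('x \<Rightarrow> 'x) set" where
  "Aut X S = {\<Phi>. \<Phi> \<in> extensional X \<and> (\<exists>\<Psi>. homeomorphism X X \<Phi> \<Psi>) \<and>
                 (\<forall>x\<in>X. \<Phi> (S x) = S (\<Phi> x))}"

section \<open>The \<open>r\<close>-adic integers and the map \<open>\<kappa>\<close>\<close>

text \<open>The inverse limit of the rings \<open>\<int>/r\<^sup>n\<int>\<close>, with residues represented in \<open>{0..<r^n}\<close>, as a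
  subspace of the product space \<open>nat \<Rightarrow> nat\<close>.\<close>

definition adic_ints :: "nat \<Rightarrow> (nat \<Rightarrow> nat) set" where
  "adic_ints r = {z. \<forall>n. z n < r ^ n \<and> z (Suc n) mod r ^ n = z n}"

definition adic_add :: "nat \<Rightarrow> (nat \<Rightarrow> nat) \<Rightarrow> (nat \<Rightarrow> nat) \<Rightarrow> nat \<Rightarrow> nat" where
  "adic_add r y z = (\<lambda>n. (y n + z n) mod r ^ n)"

definition adic_one :: "nat \<Rightarrow> nat \<Rightarrow> nat" where
  "adic_one r = (\<lambda>n. 1 mod r ^ n)"

text \<open>Factor maps from \<open>(X, S)\<close> onto \<open>(\<int>\<^sub>r, +1)\<close>.  For minimal \<open>(X, S)\<close> two such maps
  differ by a translation of \<open>\<int>\<^sub>r\<close>, and \<open>kappa\<close> is the same for both.  When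
  \<open>(\<int>\<^sub>r, +1)\<close> is the maximal equicontinuous factor, the projection to that factor is therefore,
  up to translation, the only such map.\<close>

definition adic_factor_map :: "nat \<Rightarrow> 'x::topological_space set \<Rightarrow> ('x \<Rightarrow> 'x) \<Rightarrow>
    ('x \<Rightarrow> nat \<Rightarrow> nat) \<Rightarrow> bool" where
  "adic_factor_map r X S \<pi> \<longleftrightarrow>
     continuous_on X \<pi> \<and> \<pi> ` X = adic_ints r \<and>
     (\<forall>x\<in>X. \<pi> (S x) = adic_add r (\<pi> x) (adic_one r))"

definition kappa :: "nat \<Rightarrow> 'x set \<Rightarrow> ('x \<Rightarrow> nat \<Rightarrow> nat) \<Rightarrow> ('x \<Rightarrow> 'x) \<Rightarrow> nat \<Rightarrow> nat" where
  "kappa r X \<pi> \<Phi> =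
     (THE z. z \<in> adic_ints r \<and> (\<forall>x\<in>X. \<pi> (\<Phi> x) = adic_add r z (\<pi> x)))"

end

theory Submission
  imports Defs
begin

text \<open>
  The points of the one-sided shift with more than one preimage form a finite set, because a
  constant-length substitution has at most linear factor complexity, and a nonempty one, because
  the shift is infinite.  A one-sided automorphism permutes them, so one of its powers fixes a
  point and is the identity by minimality.  Its lift to the two-sided shift has finite order,
  hence its image under \<open>\<kappa>\<close> vanishes, as \<open>\<int>\<^sub>r\<close> is torsion-free, and the lift is the identity if
  \<open>\<kappa>\<close> is injective.

  If \<open>\<theta>\<close> has a coincidence, two points with the same image in \<open>\<int>\<^sub>r\<close> have the same block
  structure at every level and therefore agree on arbitrarily long windows.  By minimality, two
  distinct automorphisms differ on every window of some fixed length.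
\<close>

section \<open>Product topology over a discrete alphabet\<close>

text \<open>Only some iterate \<theta>^m fixes \<open>u\<close>, so the levels K at which
  \<open>u\<close> is cut into words \<theta>^K(a) of length r^K are taken to be multiples of m.
  Finiteness comes from counting left extensions: b points with two preimages add, for all large
  lengths, at least b words whenever the length grows by one, while there are at most |A|^2 * r^K
  words of length r^K; hence b is at most |A|^2. Conversely, if no point had two preimages,
  compactness would give a length n such that n letters always determine the letter before them; the
  complexity would then stay bounded and the two-sided shift would be finite. Since r may be
  composite, multiplication by N can fail to be injective modulo r^n, so torsion-freeness of the
  r-adic integers has to use several levels at once.\<close>

lemma open_contains_cylinder:
  fixes U :: "('i \<Rightarrow> 'a::topological_space) set"
  assumes "open U" "x \<in> U"
  shows "\<exists>F. finite F \<and> (\<forall>y. (\<forall>i\<in>F. y i = x i) \<longrightarrow> y \<in> U)"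
proof -
  have "openin (product_topology (\<lambda>i. euclidean) UNIV) U"
    using assms(1) by (simp add: open_fun_def)
  from product_topology_open_contains_basis[OF this assms(2)]
  obtain X where X: "x \<in> (\<Pi>\<^sub>E i\<in>UNIV. X i)" "finite {i. X i \<noteq> UNIV}"
      "(\<Pi>\<^sub>E i\<in>UNIV. X i) \<subseteq> U"
    by auto
  have "y \<in> U" if "\<forall>i\<in>{i. X i \<noteq> UNIV}. y i = x i" for y
  proof -
    have "y i \<in> X i" for i
      using that X(1) by (cases "X i = UNIV") (auto simp: PiE_iff)
    then show ?thesis using X(3) by (auto simp: PiE_iff)
  qed
  with X(2) show ?thesis by blast
qed

lemma open_cylinder:
  fixes x :: "'i \<Rightarrow> 'a::discrete_topology"
  assumes "finite F"
  shows "open {y. \<forall>i\<in>F. y i = x i}"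
proof -
  have "open {y. \<forall>i\<in>F. y (id i) \<in> {x i}}"
    by (rule product_topology_basis') (auto simp: assms open_discrete)
  then show ?thesis by simp
qed

lemma continuous_on_coordinate_determined:
  fixes f :: "('i \<Rightarrow> 'a::topological_space) \<Rightarrow> ('j \<Rightarrow> 'b::discrete_topology)"
  assumes "continuous_on A f" "x \<in> A"
  shows "\<exists>F. finite F \<and> (\<forall>y\<in>A. (\<forall>i\<in>F. y i = x i) \<longrightarrow> f y j = f x j)"
proof -
  have "continuous_on A (\<lambda>y. f y j)"
    using assms(1) by (rule continuous_on_product_then_coordinatewise)
  moreover have "open {f x j}" by (rule open_discrete)
  ultimately obtain U where U: "open U" "U \<inter> A = (\<lambda>y. f y j) -` {f x j} \<inter> A"
    unfolding continuous_on_open_invariant by metis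
  then have "x \<in> U" using assms(2) by auto
  then obtain F where F: "finite F" "\<And>y. (\<forall>i\<in>F. y i = x i) \<Longrightarrow> y \<in> U"
    using open_contains_cylinder[OF U(1)] by metis
  have "f y j = f x j" if "y \<in> A" "\<forall>i\<in>F. y i = x i" for y
    using F(2)[OF that(2)] that(1) U(2) by auto
  with F(1) show ?thesis by (intro exI[of _ F] conjI ballI impI)
qed

text \<open>One separating coordinate per pair suffices. This is how finitely many points are told
  apart by words of bounded length.\<close>

lemma finite_functions_separated:
  assumes "finite (Y :: ('i \<Rightarrow> 'a) set)"
  shows "\<exists>F. finite F \<and> (\<forall>x\<in>Y. \<forall>y\<in>Y. (\<forall>i\<in>F. x i = y i) \<longrightarrow> x = y)"
proof -
  \<comment> \<open>The implication keeps the choice function \<open>d\<close> total, with no case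
    distinction for equal points.\<close>
  have "\<forall>x y :: 'i \<Rightarrow> 'a. \<exists>i. x i = y i \<longrightarrow> x = y" by auto
  then obtain d where d: "\<And>x y :: 'i \<Rightarrow> 'a. x (d x y) = y (d x y) \<Longrightarrow> x = y" by metis
  let ?F = "(\<lambda>(x, y). d x y) ` (Y \<times> Y)"
  have "x = y" if "x \<in> Y" "y \<in> Y" "\<forall>i\<in>?F. x i = y i" for x y
    using that by (intro d) auto
  moreover have "finite ?F" using assms by simp
  ultimately show ?thesis by (intro exI[of _ ?F] conjI ballI impI)
qed

text \<open>Compactness in the style of Koenig's lemma: pigeonhole extends a prefix shared by
  infinitely many sequences by one letter, and the nested prefixes are glued along the
  diagonal.\<close>

lemma infinitely_often_prefix:
  fixes s :: "nat \<Rightarrow> nat \<Rightarrow> 'b::finite"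
  shows "\<exists>x. \<forall>l. infinite {n. \<forall>k<l. s n k = x k}"
proof -
  have step: "\<exists>g. infinite {n. \<forall>k<Suc l. s n k = g k} \<and> (\<forall>k<l. g k = f k)"
    if "infinite {n. \<forall>k<l. s n k = f k}" for f :: "nat \<Rightarrow> 'b" and l
  proof -
    let ?N = "{n. \<forall>k<l. s n k = f k}"
    have "\<exists>a\<in>UNIV. infinite {n \<in> ?N. s n l = a}"
      using that by (intro pigeonhole_infinite_rel) auto
    then obtain a where "infinite {n \<in> ?N. s n l = a}" by blast
    moreover have "{n \<in> ?N. s n l = a} = {n. \<forall>k<Suc l. s n k = (f(l := a)) k}"
      by (auto simp: less_Suc_eq)
    ultimately show ?thesis by (intro exI[of _ "f(l := a)"]) auto
  qed
  have "\<exists>f. \<forall>l. infinite {n. \<forall>k<l. s n k = f l k} \<and> (\<forall>k<l. f (Suc l) k = f l k)"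
    by (rule dependent_nat_choice) (use step in simp_all)
  then obtain f where f: "\<And>l. infinite {n. \<forall>k<l. s n k = f l k}"
      "\<And>l k. k < l \<Longrightarrow> f (Suc l) k = f l k" by blast
  have diag: "f l k = f (Suc k) k" if "k < l" for l k
    using that
  proof (induction l)
    case (Suc l)
    then show ?case using f(2)[of k l] by (cases "k = l") auto
  qed simp
  have "{n. \<forall>k<l. s n k = f l k} = {n. \<forall>k<l. s n k = f (Suc k) k}" for l
    using diag by (intro Collect_cong) (metis (no_types))
  with f(1) have "\<forall>l. infinite {n. \<forall>k<l. s n k = f (Suc k) k}" by simp
  then show ?thesis by (rule exI[of _ "\<lambda>k. f (Suc k) k"])
qed

section \<open>Membership in the shifts, read off from the words of \<open>u\<close>\<close>

lemma shift_funpow_nat: "(shift ^^ n) x = (\<lambda>k::nat. x (k + n))"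
  by (induction n) (auto simp: shift_def)

lemma shift_funpow_int: "(shift ^^ n) x = (\<lambda>k::int. x (k + int n))"
  by (induction n) (auto simp: shift_def algebra_simps)

text \<open>Replaces the orbit closure by a condition on words, which works because basic
  neighbourhoods fix finitely many coordinates.\<close>

lemma one_sided_shift_iff:
  fixes u :: "nat \<Rightarrow> 'a::discrete_topology"
  shows "x \<in> one_sided_shift u \<longleftrightarrow> (\<forall>n. \<exists>j. \<forall>k<n. x k = u (j + k))"
proof
  assume x: "x \<in> one_sided_shift u"
  show "\<forall>n. \<exists>j. \<forall>k<n. x k = u (j + k)"
  proof
    fix n
    have "open {y. \<forall>k\<in>{..<n}. y k = x k}" by (rule open_cylinder) simp
    with x obtain y where "y \<in> range (\<lambda>n. (shift ^^ n) u)" "\<forall>k\<in>{..<n}. y k = x k"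
      unfolding one_sided_shift_def closure_iff_nhds_not_empty by blast
    then obtain j where "\<forall>k\<in>{..<n}. u (k + j) = x k"
      by (auto simp: shift_funpow_nat)
    then show "\<exists>j. \<forall>k<n. x k = u (j + k)"
      by (intro exI[of _ j]) (auto simp: add.commute)
  qed
next
  assume *: "\<forall>n. \<exists>j. \<forall>k<n. x k = u (j + k)"
  have "\<exists>y\<in>range (\<lambda>n. (shift ^^ n) u). y \<in> U" if U: "open U" "x \<in> U" for U
  proof -
    obtain F where F: "finite F" "\<forall>y. (\<forall>i\<in>F. y i = x i) \<longrightarrow> y \<in> U"
      using open_contains_cylinder[OF U] by blast
    obtain n where "F \<subseteq> {..<n}" using F(1) finite_nat_iff_bounded by blast
    moreover obtain j where "\<forall>k<n. x k = u (j + k)" using * by blast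
    ultimately have "\<forall>i\<in>F. (shift ^^ j) u i = x i" by (auto simp: shift_funpow_nat add.commute)
    then have "(shift ^^ j) u \<in> U" using F(2) by blast
    then show ?thesis by blast
  qed
  then show "x \<in> one_sided_shift u"
    unfolding one_sided_shift_def closure_iff_nhds_not_empty by blast
qed

text \<open>For \<open>i = 0\<close> this is the projection from the two-sided to the one-sided
  shift; all the tails together recover the point.\<close>

definition tail :: "int \<Rightarrow> (int \<Rightarrow> 'a) \<Rightarrow> nat \<Rightarrow> 'a" where
  "tail i x = (\<lambda>n. x (i + int n))"

lemma tail_shift: "tail i (shift x) = tail (i + 1) x"
  by (auto simp: shift_def tail_def algebra_simps)

lemma two_sided_shift_iff:
  "x \<in> two_sided_shift u \<longleftrightarrow> (\<forall>i. tail i x \<in> one_sided_shift u)"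
proof
  assume x: "x \<in> two_sided_shift u"
  show "\<forall>i. tail i x \<in> one_sided_shift u"
    unfolding one_sided_shift_iff
  proof (intro allI)
    fix i n
    obtain y j where y: "y \<in> one_sided_shift u" "\<forall>k<n. x (i + int k) = y (j + k)"
      using x unfolding two_sided_shift_def by blast
    obtain j' where "\<forall>k<j + n. y k = u (j' + k)"
      using y(1) unfolding one_sided_shift_iff by blast
    with y(2) have "\<forall>k<n. tail i x k = u (j' + j + k)" by (auto simp: tail_def add.assoc)
    then show "\<exists>j. \<forall>k<n. tail i x k = u (j + k)" by blast
  qed
next
  assume *: "\<forall>i. tail i x \<in> one_sided_shift u"
  have "\<exists>y\<in>one_sided_shift u. \<exists>j. \<forall>k<n. x (i + int k) = y (j + k)" for i n
    by (rule bexI[of _ "tail i x"], rule exI[of _ 0]) (use * in \<open>auto simp: tail_def\<close>)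
  then show "x \<in> two_sided_shift u" by (auto simp: two_sided_shift_def)
qed

section \<open>Iterates of a substitution\<close>

lemma subst_seq_funpow_Suc:
  "(subst_seq r \<theta> ^^ Suc K) v n = \<theta> ((subst_seq r \<theta> ^^ K) v (n div r)) ! (n mod r)"
  by (simp add: subst_seq_def)

text \<open>A letter of an iterate depends on a single letter of the original sequence. So the
  iterate of the constant sequence \<open>a\<close>, which is the word \<theta>^K(a) repeated
  periodically, can stand for that word.\<close>

lemma subst_seq_funpow_block:
  "(subst_seq r \<theta> ^^ K) v n = (subst_seq r \<theta> ^^ K) (\<lambda>_. v (n div r ^ K)) n"
  by (induction K arbitrary: n) (auto simp: subst_seq_def div_mult2_eq mult.commute)

lemma subst_seq_funpow_const_mod:
  "(subst_seq r \<theta> ^^ K) (\<lambda>_. a) (n mod r ^ K) = (subst_seq r \<theta> ^^ K) (\<lambda>_. a) n"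
proof (induction K arbitrary: n)
  case (Suc K)
  have "(n mod r ^ Suc K) mod r = n mod r"
    by (simp add: mod_mod_cancel)
  moreover have "(n mod r ^ Suc K) div r = (n div r) mod r ^ K"
    by (cases "r = 0") (auto simp: mod_mult2_eq)
  ultimately show ?case using Suc by (simp add: subst_seq_def)
qed simp

lemma subst_seq_funpow_add_mult:
  assumes "0 < r"
  shows "(subst_seq r \<theta> ^^ K) v (q * r ^ K + n) = (subst_seq r \<theta> ^^ K) (\<lambda>i. v (q + i)) n"
proof -
  have "(subst_seq r \<theta> ^^ K) v (q * r ^ K + n)
      = (subst_seq r \<theta> ^^ K) (\<lambda>_. v (q + n div r ^ K)) (q * r ^ K + n)"
    by (subst subst_seq_funpow_block) (use assms in simp)
  also have "\<dots> = (subst_seq r \<theta> ^^ K) (\<lambda>_. v (q + n div r ^ K)) n"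
    by (subst (1 2) subst_seq_funpow_const_mod [symmetric]) simp
  finally show ?thesis by (subst (2) subst_seq_funpow_block)
qed

lemma concat_map_nth:
  assumes "\<forall>a. length (\<theta> a) = r" "n < length w * r"
  shows "concat (map \<theta> w) ! n = \<theta> (w ! (n div r)) ! (n mod r)"
  using assms(2)
proof (induction w arbitrary: n)
  case (Cons a w)
  show ?case
  proof (cases "n < r")
    case True
    then show ?thesis using assms(1) by (simp add: nth_append)
  next
    case False
    then have "n div r = Suc ((n - r) div r)" "n mod r = (n - r) mod r"
      using Cons.prems by (cases "r = 0"; auto simp: le_div_geq le_mod_geq)+
    moreover have "n - r < length w * r" using Cons.prems False by auto
    ultimately show ?thesis using Cons.IH[of "n - r"] False assms(1) by (simp add: nth_append)
  qed
qed simp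

lemma subst_word_funpow_eq:
  assumes "\<forall>a. length (\<theta> a) = r"
  shows "(subst_word \<theta> ^^ k) [a] = map ((subst_seq r \<theta> ^^ k) (\<lambda>_. a)) [0..<r ^ k]"
proof (induction k)
  case (Suc k)
  let ?f = "(subst_seq r \<theta> ^^ k) (\<lambda>_. a)"
  have len: "length (concat (map \<theta> (map ?f [0..<r ^ k]))) = r ^ Suc k"
    using assms by (simp add: length_concat o_def sum_list_triv)
  show ?case
  proof (rule nth_equalityI)
    show "length ((subst_word \<theta> ^^ Suc k) [a])
        = length (map ((subst_seq r \<theta> ^^ Suc k) (\<lambda>_. a)) [0..<r ^ Suc k])"
      using len by (simp add: Suc subst_word_def)
    fix n assume "n < length ((subst_word \<theta> ^^ Suc k) [a])"
    then have n: "n < r ^ k * r" using len by (simp add: Suc subst_word_def mult.commute)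
    then have "n div r < r ^ k" by (simp add: less_mult_imp_div_less)
    with n show "(subst_word \<theta> ^^ Suc k) [a] ! n
        = map ((subst_seq r \<theta> ^^ Suc k) (\<lambda>_. a)) [0..<r ^ Suc k] ! n"
      using concat_map_nth[OF assms, of n "map ?f [0..<r ^ k]"]
      by (simp add: Suc subst_word_def subst_seq_funpow_Suc mult.commute del: funpow.simps(2))
        (simp add: subst_word_def Suc)
  qed
qed simp

text \<open>The composition of columns \<open>i\<^sub>1, \<dots>, i\<^sub>k\<close> is the column of \<open>\<theta>\<^sup>k\<close> whose index has
  the base-\<open>r\<close> digits \<open>i\<^sub>1, \<dots>, i\<^sub>k\<close>, least significant digit first.\<close>

lemma foldr_column_eq:
  assumes "0 < r" "set is \<subseteq> {..<r}"
  shows "\<exists>s<r ^ length is. \<forall>a. foldr (\<lambda>i g. column \<theta> i \<circ> g) is id a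
           = (subst_seq r \<theta> ^^ length is) (\<lambda>_. a) s"
  using assms(2)
proof (induction "is")
  case (Cons i "is")
  then obtain s where s: "s < r ^ length is" "\<forall>a. foldr (\<lambda>i g. column \<theta> i \<circ> g) is id a
           = (subst_seq r \<theta> ^^ length is) (\<lambda>_. a) s"
    by (metis insert_subset list.simps(15))
  have "i < r" using Cons.prems by auto
  moreover have "s * r + i < r ^ length (i # is)"
  proof -
    have "s * r + i < Suc s * r" using \<open>i < r\<close> by simp
    also have "\<dots> \<le> r ^ length is * r" using s(1) by (intro mult_right_mono) auto
    finally show ?thesis by (simp add: mult.commute)
  qed
  moreover have "foldr (\<lambda>i g. column \<theta> i \<circ> g) (i # is) id a
      = (subst_seq r \<theta> ^^ length (i # is)) (\<lambda>_. a) (s * r + i)" for a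
  proof -
    have "foldr (\<lambda>i g. column \<theta> i \<circ> g) (i # is) id a
        = \<theta> (foldr (\<lambda>i g. column \<theta> i \<circ> g) is id a) ! i"
      by (simp add: column_def)
    with \<open>i < r\<close> show ?thesis
      by (simp only: s(2) length_Cons subst_seq_funpow_Suc) simp
  qed
  ultimately show ?case by blast
qed auto

lemma coincidence_iterate:
  assumes "0 < r" "has_coincidence r \<theta>"
  shows "\<exists>k s. 1 \<le> k \<and> s < r ^ k \<and>
           (\<forall>a b. (subst_seq r \<theta> ^^ k) (\<lambda>_. a) s = (subst_seq r \<theta> ^^ k) (\<lambda>_. b) s)"
proof -
  obtain "is" where i: "is \<noteq> []" "set is \<subseteq> {..<r}"
      "card (range (foldr (\<lambda>i g. column \<theta> i \<circ> g) is id)) = 1"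
    using assms(2) unfolding has_coincidence_def by blast
  obtain s where s: "s < r ^ length is" "\<forall>a. foldr (\<lambda>i g. column \<theta> i \<circ> g) is id a
           = (subst_seq r \<theta> ^^ length is) (\<lambda>_. a) s"
    using foldr_column_eq[OF assms(1) i(2)] by blast
  obtain c where "range (foldr (\<lambda>i g. column \<theta> i \<circ> g) is id) = {c}"
    using i(3) card_1_singletonE by blast
  then have "foldr (\<lambda>i g. column \<theta> i \<circ> g) is id a = c" for a by blast
  then show ?thesis using s i(1)
    by (intro exI[of _ "length is"] exI[of _ s]) (auto simp: Suc_le_eq)
qed

section \<open>Automorphisms and the \<open>r\<close>-adic integers\<close>

lemma Aut_shift_funpow:
  assumes "\<And>x. x \<in> X \<Longrightarrow> \<Phi> (T x) = T (\<Phi> x)" "\<And>x. x \<in> X \<Longrightarrow> T x \<in> X" "x \<in> X"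
  shows "\<Phi> ((T ^^ n) x) = (T ^^ n) (\<Phi> x)"
proof (induction n)
  case (Suc n)
  have "(T ^^ n) x \<in> X" by (induction n) (use assms in auto)
  then show ?case using Suc assms(1) by simp
qed simp

lemma AutD:
  assumes "\<Phi> \<in> Aut X T"
  shows "\<Phi> \<in> extensional X" "continuous_on X \<Phi>" "\<Phi> ` X = X" "inj_on \<Phi> X"
    "x \<in> X \<Longrightarrow> \<Phi> x \<in> X" "x \<in> X \<Longrightarrow> \<Phi> (T x) = T (\<Phi> x)"
proof -
  obtain \<Psi> where "homeomorphism X X \<Phi> \<Psi>" "\<Phi> \<in> extensional X"
    "\<forall>x\<in>X. \<Phi> (T x) = T (\<Phi> x)" using assms by (auto simp: Aut_def)
  then show "\<Phi> \<in> extensional X" "continuous_on X \<Phi>" "\<Phi> ` X = X" "inj_on \<Phi> X"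
    "x \<in> X \<Longrightarrow> \<Phi> x \<in> X" "x \<in> X \<Longrightarrow> \<Phi> (T x) = T (\<Phi> x)"
    by (auto simp: homeomorphism_def intro: inj_on_inverseI)
qed

lemma restrict_id_in_Aut:
  assumes "\<And>x. x \<in> X \<Longrightarrow> T x \<in> X"
  shows "restrict id X \<in> Aut X T"
proof -
  have "homeomorphism X X (restrict id X) (restrict id X)"
    by (rule homeomorphismI) (auto intro: continuous_on_eq[OF continuous_on_id])
  then show ?thesis using assms by (auto simp: Aut_def)
qed

section \<open>Subtraction and torsion in the r-adic integers\<close>

lemma adic_add_cancel:
  assumes "z \<in> adic_ints r" "z' \<in> adic_ints r" "adic_add r z y = adic_add r z' y"
  shows "z = z'"
proof
  fix n
  have "(z n + y n) mod r ^ n = (z' n + y n) mod r ^ n"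
    using fun_cong[OF assms(3), of n] by (simp add: adic_add_def)
  \<comment> \<open>In the integers, congruence is divisibility of a difference, from which the
    common summand drops out.\<close>
  then have "int (z n + y n) mod int (r ^ n) = int (z' n + y n) mod int (r ^ n)"
    by (simp only: zmod_int[symmetric])
  then have "int (z n) mod int (r ^ n) = int (z' n) mod int (r ^ n)"
    by (simp add: mod_eq_dvd_iff del: of_nat_power)
  then have "z n mod r ^ n = z' n mod r ^ n" by (simp only: zmod_int[symmetric] of_nat_eq_iff)
  then show "z n = z' n" using assms(1,2) by (simp add: adic_ints_def)
qed

lemma adic_difference:
  assumes "y \<in> adic_ints r" "w \<in> adic_ints r" and r_pos: "0 < r"
  shows "\<exists>z\<in>adic_ints r. adic_add r z w = y"
proof -
  define z where "z n = nat ((int (y n) - int (w n)) mod int (r ^ n))" for n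
  have z: "int (z n) = (int (y n) - int (w n)) mod int (r ^ n)" for n
    using r_pos by (simp add: z_def)
  have mod: "y (Suc n) mod r ^ n = y n" "w (Suc n) mod r ^ n = w n" "y n < r ^ n" for n
    using assms by (auto simp: adic_ints_def)
  have "int (z (Suc n) mod r ^ n) = int (z n)" for n
  proof -
    have "int (z (Suc n) mod r ^ n) = (int (y (Suc n)) - int (w (Suc n))) mod int (r ^ n)"
      unfolding zmod_int z by (simp add: mod_mod_cancel)
    also have "\<dots> = (int (y (Suc n)) mod int (r ^ n) - int (w (Suc n)) mod int (r ^ n)) mod int (r ^ n)"
      by (simp add: mod_diff_eq)
    also have "\<dots> = int (z n)" by (simp only: zmod_int[symmetric] mod z)
    finally show ?thesis .
  qed
  moreover have "int (z n) < int (r ^ n)" for n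
    unfolding z using r_pos by (intro pos_mod_bound) simp
  ultimately have "z \<in> adic_ints r" by (auto simp: adic_ints_def simp del: of_nat_power)
  moreover have "adic_add r z w = y"
  proof
    fix n
    have "int ((z n + w n) mod r ^ n) = int (y n) mod int (r ^ n)"
      unfolding zmod_int of_nat_add z by (simp add: mod_add_left_eq)
    also have "\<dots> = int (y n)" using mod(3) by (simp add: zmod_int[symmetric] del: of_nat_power)
    finally show "adic_add r z w n = y n" by (simp add: adic_add_def del: of_nat_power)
  qed
  ultimately show ?thesis by blast
qed

text \<open>A factor of N coprime to r cancels modulo r^n. Otherwise g = gcd(N, r) can be removed
  from N at the price of one level, which is affordable because the hypothesis holds at all levels;
  then induct on N.\<close>

lemma adic_torsion_free:
  assumes "z \<in> adic_ints r" "0 < N" "\<And>n. r ^ n dvd N * z n" and r_pos: "0 < r"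
  shows "z n = 0"
proof -
  have "r ^ n dvd z n" for n
    using assms(2,3)
  proof (induction N arbitrary: n rule: less_induct)
    case (less N)
    show ?case
    proof (cases "coprime N r")
      case True
      then have "coprime (r ^ n) N" by (simp add: coprime_commute)
      then show ?thesis using less.prems(2)[of n] by (simp add: coprime_dvd_mult_right_iff)
    next
      case False
      define g where "g = gcd N r"
      obtain N' where N': "N = g * N'" unfolding g_def by (metis dvdE gcd_dvd1)
      have "g \<noteq> 1" using False by (simp add: g_def coprime_iff_gcd_eq_1)
      moreover have "g \<noteq> 0" using less.prems(1) by (simp add: g_def)
      ultimately have g: "1 < g" by linarith
      obtain c where c: "r = g * c" unfolding g_def by (metis dvdE gcd_dvd2)
      have "r ^ n dvd N' * z n" for n
      proof -
        \<comment> \<open>Multiplying by the cofactor c = r / g turns N into r * N', so one power of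
          r cancels; compatibility of z brings level n + 1 back to level n.\<close>
        have "r ^ Suc n dvd c * (N * z (Suc n))" using less.prems(2) by (rule dvd_mult)
        then have "r * r ^ n dvd r * (N' * z (Suc n))" by (simp add: N' c ac_simps)
        then have "r ^ n dvd N' * z (Suc n)" using r_pos by simp
        moreover have "z (Suc n) mod r ^ n = z n" using assms(1) by (simp add: adic_ints_def)
        ultimately show ?thesis by (metis dvd_eq_mod_eq_0 mod_mult_right_eq)
      qed
      moreover have "N' < N" "0 < N'" using N' g less.prems(1) by auto
      ultimately show ?thesis using less.IH by blast
    qed
  qed
  moreover have "z n < r ^ n" using assms(1) by (simp add: adic_ints_def)
  ultimately show ?thesis by (meson dvd_imp_le leD neq0_conv)
qed

section \<open>Minimality\<close>

lemma shift_in_one_sided_shift: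
  assumes "x \<in> one_sided_shift u"
  shows "shift x \<in> one_sided_shift u"
  unfolding one_sided_shift_iff
proof
  fix n
  obtain j where "\<forall>k<Suc n. x k = u (j + k)"
    using assms unfolding one_sided_shift_iff by blast
  then show "\<exists>j. \<forall>k<n. shift x k = u (j + k)"
    by (intro exI[of _ "Suc j"]) (auto simp: shift_def)
qed

lemma shift_funpow_in_one_sided_shift:
  "x \<in> one_sided_shift u \<Longrightarrow> (shift ^^ n) x \<in> one_sided_shift u"
  by (induction n) (auto simp: shift_in_one_sided_shift)

lemma shift_in_two_sided_shift: "x \<in> two_sided_shift u \<Longrightarrow> shift x \<in> two_sided_shift u"
  by (auto simp: two_sided_shift_iff tail_shift)

lemma shift_funpow_in_two_sided_shift:
  "x \<in> two_sided_shift u \<Longrightarrow> (shift ^^ n) x \<in> two_sided_shift u"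
  by (induction n) (auto simp: shift_in_two_sided_shift)

lemma base_in_one_sided_shift: "u \<in> one_sided_shift u"
  unfolding one_sided_shift_iff by (metis add_0)

lemma finite_int_abs_bounded:
  assumes "finite (F :: int set)"
  shows "\<exists>N. \<forall>i\<in>F. \<bar>i\<bar> < int N"
proof -
  obtain M where "\<And>k. k \<in> (\<lambda>i. nat \<bar>i\<bar>) ` F \<Longrightarrow> k < M"
    using assms finite_nat_set_iff_bounded[of "(\<lambda>i. nat \<bar>i\<bar>) ` F"] by auto
  then have "\<forall>i\<in>F. \<bar>i\<bar> < int M" by (fastforce simp: zless_nat_eq_int_zless)
  then show ?thesis by blast
qed

text \<open>Primitivity is phrased through positions in \<theta>^k(a), so that it meets the block
  formulas for iterates directly. \<open>m\<close> is a period of \<open>u\<close> under the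
  substitution.\<close>

locale primitive_fixed_point =
  fixes r :: nat and \<theta> :: "'a::{finite,discrete_topology} \<Rightarrow> 'a list"
    and u :: "nat \<Rightarrow> 'a" and m :: nat
  assumes r_ge_2: "2 \<le> r"
    and primitive_columns: "\<exists>k. \<forall>a b. \<exists>s<r ^ k. (subst_seq r \<theta> ^^ k) (\<lambda>_. a) s = b"
    and m_pos: "1 \<le> m"
    and fixed: "(subst_seq r \<theta> ^^ m) u = u"
begin

abbreviation "S \<equiv> subst_seq r \<theta>"

lemma r_pos: "0 < r"
  using r_ge_2 by simp

lemma fixed_power: "m dvd K \<Longrightarrow> (S ^^ K) u = u"
proof -
  have "(S ^^ (m * l)) u = u" for l
    by (induction l) (auto simp: funpow_add fixed)
  then show "m dvd K \<Longrightarrow> (S ^^ K) u = u" by (auto elim: dvdE)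
qed

text \<open>Applying \<theta>^k to the first letter of \<theta>^l(a) shows that every exponent k + l
  inherits the property; l = k(m - 1) makes the exponent a multiple of m.\<close>

lemma primitive_multiple: "\<exists>k. m dvd k \<and> (\<forall>a b. \<exists>s<r ^ k. (S ^^ k) (\<lambda>_. a) s = b)"
proof -
  obtain k where k: "\<And>a b. \<exists>s<r ^ k. (S ^^ k) (\<lambda>_. a) s = b"
    using primitive_columns by blast
  have "\<exists>s<r ^ (k + l). (S ^^ (k + l)) (\<lambda>_. a) s = b" for l a b
  proof -
    obtain s where s: "s < r ^ k" "(S ^^ k) (\<lambda>_. (S ^^ l) (\<lambda>_. a) 0) s = b"
      using k by blast
    have "(S ^^ (k + l)) (\<lambda>_. a) s = b"
      using s by (subst funpow_add) (simp add: subst_seq_funpow_block[where v = "(S ^^ l) (\<lambda>_. a)"])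
    moreover have "r ^ k \<le> r ^ (k + l)" using r_pos by (intro power_increasing) auto
    ultimately show ?thesis using s(1) by (intro exI[of _ s]) auto
  qed
  moreover have "k + k * (m - 1) = m * k" using m_pos by (cases m) auto
  ultimately show ?thesis by (metis dvd_triv_left)
qed

text \<open>If the word occurs in \<open>\<theta>\<^sup>K(u\<^sub>0)\<close>, then it occurs in \<open>\<theta>\<^bsup>K+k\<^esup>(a)\<close> for every letter \<open>a\<close>, hence
  in every window that contains a full block of level \<open>K + k\<close>.\<close>

lemma recurrence:
  "\<exists>G. \<forall>q. \<exists>p\<ge>q. p + n \<le> q + G \<and> (\<forall>t<n. u (p + t) = u (j + t))"
proof -
  obtain k where k: "m dvd k" "\<And>a b. \<exists>s<r ^ k. (S ^^ k) (\<lambda>_. a) s = b"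
    using primitive_multiple by blast
  \<comment> \<open>A multiple of m with r^K > j + n, so the occurrence at \<open>j\<close> lies
    inside the initial block \<theta>^K(u 0).\<close>
  define K where "K = m * (j + n)"
  have "j + n \<le> K" using m_pos by (simp add: K_def)
  also have "K < 2 ^ K" by (rule less_exp)
  also have "2 ^ K \<le> r ^ K" using r_ge_2 by (rule power_mono) simp
  finally have K: "j + n < r ^ K" .
  have uK: "(S ^^ K) u = u" by (rule fixed_power) (simp add: K_def)
  have uk: "(S ^^ k) u = u" by (rule fixed_power) (rule k(1))
  let ?M = "r ^ k * r ^ K"
  have M: "0 < ?M" using r_pos by simp
  have "\<exists>p\<ge>q. p + n \<le> q + 2 * ?M \<and> (\<forall>t<n. u (p + t) = u (j + t))" for q
  proof -
    \<comment> \<open>The first block of level k + K to start after \<open>q\<close>; it ends no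
      later than q + 2M. Inside it, \<theta>^k of its letter contains u 0 at offset
      \<open>s\<close>.\<close>
    let ?Q = "Suc (q div ?M)"
    obtain s where s: "s < r ^ k" "(S ^^ k) (\<lambda>_. u ?Q) s = u 0" using k(2) by blast
    have u_block: "u (?Q * r ^ k + s) = u 0"
    proof -
      have "u (?Q * r ^ k + s) = (S ^^ k) (\<lambda>_. u ((?Q * r ^ k + s) div r ^ k)) (?Q * r ^ k + s)"
        by (subst (1) uk[symmetric]) (rule subst_seq_funpow_block)
      also have "(?Q * r ^ k + s) div r ^ k = ?Q" using s(1) r_pos by (simp del: mult_Suc)
      also have "(S ^^ k) (\<lambda>_. u ?Q) (?Q * r ^ k + s) = (S ^^ k) (\<lambda>_. u ?Q) s"
        by (subst (1 2) subst_seq_funpow_const_mod[symmetric]) (simp del: mult_Suc)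
      finally show ?thesis using s(2) by simp
    qed
    let ?p = "(?Q * r ^ k + s) * r ^ K + j"
    have "u (?p + t) = u (j + t)" if "t < n" for t
    proof -
      have jt: "j + t < r ^ K" using that K by simp
      have "u (?p + t) = (S ^^ K) (\<lambda>_. u ((?p + t) div r ^ K)) (?p + t)"
        by (subst (1) uK[symmetric]) (rule subst_seq_funpow_block)
      also have "(?p + t) div r ^ K = ?Q * r ^ k + s"
        using jt r_pos by (simp del: mult_Suc add: add.assoc)
      also have "(S ^^ K) (\<lambda>_. u (?Q * r ^ k + s)) (?p + t) = (S ^^ K) (\<lambda>_. u 0) (j + t)"
        unfolding u_block
        by (subst (1 2) subst_seq_funpow_const_mod[symmetric]) (simp del: mult_Suc add: add.assoc)
      also have "\<dots> = (S ^^ K) (\<lambda>_. u ((j + t) div r ^ K)) (j + t)" using jt by simp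
      also have "\<dots> = (S ^^ K) u (j + t)" by (rule subst_seq_funpow_block[symmetric])
      finally show ?thesis by (simp add: uK)
    qed
    moreover have "q \<le> ?p"
    proof -
      have "q < ?Q * ?M" using M by (simp add: dividend_less_div_times add.commute)
      then show ?thesis by (simp add: algebra_simps)
    qed
    moreover have "?p + n \<le> q + 2 * ?M"
    proof -
      have "?p + n \<le> (?Q * r ^ k + s) * r ^ K + r ^ K" using K by simp
      also have "\<dots> = (?Q * r ^ k + Suc s) * r ^ K" by (simp add: algebra_simps)
      also have "\<dots> \<le> (?Q * r ^ k + r ^ k) * r ^ K"
        using s(1) by (intro mult_right_mono add_left_mono) auto
      also have "\<dots> = (q div ?M) * ?M + 2 * ?M" by (simp add: algebra_simps)
      also have "\<dots> \<le> q + 2 * ?M" by (simp add: div_times_less_eq_dividend)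
      finally show ?thesis .
    qed
    ultimately show ?thesis by blast
  qed
  then show ?thesis by blast
qed

text \<open>The bound is uniform in \<open>y\<close> because every window of length \<open>G\<close>
  in \<open>y\<close> is also a window of \<open>u\<close>, to which \<open>recurrence\<close>
  applies.\<close>

lemma one_sided_minimal:
  assumes "w \<in> one_sided_shift u"
  shows "\<exists>G. \<forall>y\<in>one_sided_shift u. \<exists>p. p + n \<le> G \<and> (\<forall>t<n. y (p + t) = w t)"
proof -
  obtain j where j: "\<forall>t<n. w t = u (j + t)" using assms unfolding one_sided_shift_iff by blast
  obtain G where G: "\<And>q. \<exists>p\<ge>q. p + n \<le> q + G \<and> (\<forall>t<n. u (p + t) = u (j + t))"
    using recurrence by blast
  have "\<exists>p. p + n \<le> G \<and> (\<forall>t<n. y (p + t) = w t)" if y: "y \<in> one_sided_shift u" for y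
  proof -
    obtain q where q: "\<forall>k<G. y k = u (q + k)" using y unfolding one_sided_shift_iff by blast
    obtain p where p: "p \<ge> q" "p + n \<le> q + G" "\<forall>t<n. u (p + t) = u (j + t)" using G by blast
    have "y (p - q + t) = w t" if "t < n" for t
    proof -
      have "y (p - q + t) = u (q + (p - q + t))" using q p(1,2) that by auto
      then show ?thesis using p(1,3) j that by simp
    qed
    with p(1,2) show ?thesis by (intro exI[of _ "p - q"]) auto
  qed
  then show ?thesis by blast
qed

text \<open>Finite coordinate sets are the form in which continuity delivers its windows. One bound
  serves every start \<open>q\<close>, so patterns recur with bounded gaps in both
  directions.\<close>

lemma two_sided_minimal:
  assumes "x \<in> two_sided_shift u" "finite F"
  shows "\<exists>G. \<forall>y\<in>two_sided_shift u. \<forall>q. \<exists>p<G. \<forall>i\<in>F. y (q + int p + i) = x i"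
proof -
  obtain N where N: "\<And>i. i \<in> F \<Longrightarrow> \<bar>i\<bar> < int N"
    using finite_int_abs_bounded[OF assms(2)] by blast
  have "tail (- int N) x \<in> one_sided_shift u"
    using assms(1) by (simp add: two_sided_shift_iff)
  from one_sided_minimal[OF this, of "Suc (2 * N)"] obtain G where
    G: "\<And>y. y \<in> one_sided_shift u \<Longrightarrow>
          \<exists>p. p + Suc (2 * N) \<le> G \<and> (\<forall>t<Suc (2 * N). y (p + t) = tail (- int N) x t)"
    by blast
  have "\<exists>p<G. \<forall>i\<in>F. y (q + int p + i) = x i" if "y \<in> two_sided_shift u" for y q
  proof -
    have "tail (q - int N) y \<in> one_sided_shift u" using that by (simp add: two_sided_shift_iff)
    then obtain p where p: "p + Suc (2 * N) \<le> G"
        "\<And>t. t < Suc (2 * N) \<Longrightarrow> tail (q - int N) y (p + t) = tail (- int N) x t"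
      using G by blast
    have "y (q + int p + i) = x i" if "i \<in> F" for i
    proof -
      have "0 \<le> i + int N" "nat (i + int N) < Suc (2 * N)" using N[OF that] by linarith+
      then show ?thesis using p(2)[of "nat (i + int N)"] by (simp add: tail_def algebra_simps)
    qed
    with p(1) show ?thesis by (intro exI[of _ p]) auto
  qed
  then show ?thesis by blast
qed

section \<open>Preimages and extensions to the left\<close>

text \<open>By recurrence each prefix of \<open>x\<close> occurs in \<open>u\<close> at a positive
  position and so has a letter before it. Pigeonhole finds one letter that precedes arbitrarily long
  prefixes.\<close>

lemma shift_surj:
  assumes x: "x \<in> one_sided_shift u"
  shows "\<exists>y\<in>one_sided_shift u. shift y = x"
proof -
  have "\<exists>j. \<forall>k<n. x k = u (Suc j + k)" for n
  proof -
    obtain j where j: "\<forall>k<n. x k = u (j + k)" using x unfolding one_sided_shift_iff by blast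
    obtain p where "p \<ge> 1" "\<forall>t<n. u (p + t) = u (j + t)" using recurrence[of n j] by blast
    with j show ?thesis by (intro exI[of _ "p - 1"]) auto
  qed
  then obtain J where J: "\<And>n k. k < n \<Longrightarrow> x k = u (Suc (J n) + k)" by metis
  have "\<exists>a\<in>UNIV. infinite {n \<in> UNIV. u (J n) = a}"
    by (rule pigeonhole_infinite_rel) auto
  then obtain a where a: "infinite {n. u (J n) = a}" by auto
  have "case_nat a x \<in> one_sided_shift u"
    unfolding one_sided_shift_iff
  proof
    fix n
    obtain n' where "n \<le> n'" "u (J n') = a"
      using a unfolding infinite_nat_iff_unbounded_le by auto
    then have "\<forall>k<n. case_nat a x k = u (J n' + k)"
      using J[of _ n'] by (auto split: nat.split)
    then show "\<exists>j. \<forall>k<n. case_nat a x k = u (j + k)" by blast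
  qed
  then show ?thesis by (intro bexI[of _ "case_nat a x"]) (auto simp: shift_def)
qed

text \<open>Choose successive preimages; \<open>f n\<close> becomes the tail of the extension at
  \<open>- n\<close>.\<close>

lemma two_sided_extension:
  assumes x: "x \<in> one_sided_shift u"
  shows "\<exists>x'\<in>two_sided_shift u. tail 0 x' = x"
proof -
  have "\<exists>f. \<forall>n. (f n \<in> one_sided_shift u \<and> (n = 0 \<longrightarrow> f n = x)) \<and> shift (f (Suc n)) = f n"
    by (rule dependent_nat_choice) (use x shift_surj in auto)
  then obtain f where f: "\<And>n. f n \<in> one_sided_shift u" "f 0 = x" "\<And>n. shift (f (Suc n)) = f n"
    by blast
  have f_add: "f (n + k) (k + t) = f n t" for n k t
  proof (induction k)
    case (Suc k)
    then show ?case using f(3)[of "n + k"] by (simp add: shift_def fun_eq_iff)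
  qed simp
  define x' where "x' i = (if i \<ge> 0 then x (nat i) else f (nat (- i)) 0)" for i
  have x': "x' (int k - int n) = f n k" for n k
  proof (cases "k < n")
    case True
    then obtain d where "n = d + k" "0 < d" by (metis add.commute less_imp_add_positive)
    then show ?thesis using f_add[of d k 0] by (simp add: x'_def)
  next
    case False
    then show ?thesis using f_add[of 0 n "k - n"] f(2) by (simp add: x'_def nat_diff_distrib)
  qed
  have "tail i x' \<in> one_sided_shift u" for i
  proof (cases "i \<ge> 0")
    case True
    then have "tail i x' = (shift ^^ nat i) x"
      by (auto simp: tail_def shift_funpow_nat x'_def nat_add_distrib add.commute)
    then show ?thesis using x by (simp add: shift_funpow_in_one_sided_shift)
  next
    case False
    then have "tail i x' = f (nat (- i))"
      using x'[of _ "nat (- i)"] by (auto simp: tail_def algebra_simps)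
    then show ?thesis using f(1) by simp
  qed
  moreover have "tail 0 x' = x" by (auto simp: tail_def x'_def)
  ultimately show ?thesis by (auto simp: two_sided_shift_iff)
qed

section \<open>Points with several preimages under the one-sided shift\<close>

text \<open>The cardinality of this set is the factor complexity of \<open>u\<close>.\<close>

definition factors :: "nat \<Rightarrow> 'a list set" where
  "factors n = range (\<lambda>j. map (\<lambda>t. u (j + t)) [0..<n])"

text \<open>In combinatorics on words, these are the left special infinite words.\<close>

definition branch_points :: "(nat \<Rightarrow> 'a) set" where
  "branch_points = {z. \<exists>x\<in>one_sided_shift u. \<exists>y\<in>one_sided_shift u.
     x \<noteq> y \<and> shift x = z \<and> shift y = z}"

lemma branch_points_subset: "branch_points \<subseteq> one_sided_shift u"
  by (auto simp: branch_points_def shift_in_one_sided_shift)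

lemma finite_factors: "finite (factors n)"
proof (rule finite_subset)
  show "factors n \<subseteq> {w. set w \<subseteq> UNIV \<and> length w = n}" by (auto simp: factors_def)
qed (rule finite_lists_length_eq, simp)

lemma prefix_in_factors: "z \<in> one_sided_shift u \<Longrightarrow> map z [0..<n] \<in> factors n"
proof -
  assume "z \<in> one_sided_shift u"
  then obtain j where "\<forall>k<n. z k = u (j + k)" unfolding one_sided_shift_iff by blast
  then have "map z [0..<n] = map (\<lambda>t. u (j + t)) [0..<n]" by simp
  then show ?thesis unfolding factors_def by (rule range_eqI)
qed

lemma map_upt_Suc_shift: "map x [0..<Suc n] = x 0 # map (shift x) [0..<n]"
  by (simp add: shift_def map_upt_Suc del: upt_Suc)

text \<open>A window of length r^K meets at most two consecutive blocks \<theta>^K(a) \<theta>^K(b),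
  so \<open>a\<close>, \<open>b\<close> and the offset in the first block determine it.\<close>

lemma card_factors_le:
  assumes "m dvd K"
  shows "card (factors (r ^ K)) \<le> card (UNIV :: 'a set) ^ 2 * r ^ K"
proof -
  let ?R = "r ^ K"
  let ?D = "(UNIV :: 'a set) \<times> (UNIV :: 'a set) \<times> {..<?R}"
  define g where "g = (\<lambda>(a :: 'a, b, s).
    map (\<lambda>t. (S ^^ K) (\<lambda>i. if i = 0 then a else b) (s + t)) [0..<?R])"
  have "factors ?R \<subseteq> g ` ?D"
  proof
    fix w assume "w \<in> factors ?R"
    then obtain j where w: "w = map (\<lambda>t. u (j + t)) [0..<?R]" by (auto simp: factors_def)
    let ?q = "j div ?R" and ?s = "j mod ?R"
    have s: "?s < ?R" using r_pos by simp
    have "u (j + t) = (S ^^ K) (\<lambda>i. if i = 0 then u ?q else u (Suc ?q)) (?s + t)"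
      if "t < ?R" for t
    proof -
      have "(?s + t) div ?R < 2" using s that by (intro less_mult_imp_div_less) simp
      then have div: "(?s + t) div ?R = 0 \<or> (?s + t) div ?R = 1" by linarith
      have "u (j + t) = (S ^^ K) u (?q * ?R + (?s + t))"
        using fixed_power[OF assms] by (simp only: add.assoc[symmetric] div_mult_mod_eq)
      also have "\<dots> = (S ^^ K) (\<lambda>i. u (?q + i)) (?s + t)"
        using r_pos by (rule subst_seq_funpow_add_mult)
      also have "\<dots> = (S ^^ K) (\<lambda>_. u (?q + (?s + t) div ?R)) (?s + t)"
        by (rule subst_seq_funpow_block)
      also have "u (?q + (?s + t) div ?R) = (if (?s + t) div ?R = 0 then u ?q else u (Suc ?q))"
        using div by auto
      finally show ?thesis
        by (subst subst_seq_funpow_block)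
    qed
    then have "w = g (u ?q, u (Suc ?q), ?s)" by (simp add: w g_def)
    then show "w \<in> g ` ?D" using s by (intro image_eqI) auto
  qed
  then have "card (factors ?R) \<le> card ?D"
    by (rule surj_card_le[rotated]) simp
  then show ?thesis by (simp add: card_cartesian_product power2_eq_square)
qed

text \<open>Every word extends to the left, and a prefix of a branch point does so in two ways. From
  \<open>n0\<close> on, distinct points of \<open>B\<close> have distinct prefixes, so each
  contributes its own extra word.\<close>

lemma card_factors_Suc_ge:
  assumes B: "finite B" "B \<subseteq> branch_points"
  shows "\<exists>n0. \<forall>n\<ge>n0. card (factors n) + card B \<le> card (factors (Suc n))"
proof -
  obtain F where F: "finite F" "\<And>x y. x \<in> B \<Longrightarrow> y \<in> B \<Longrightarrow> (\<forall>i\<in>F. x i = y i) \<Longrightarrow> x = y"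
    using finite_functions_separated[OF B(1)] by blast
  obtain n0 where n0: "F \<subseteq> {..<n0}" using F(1) finite_nat_iff_bounded by blast
  have "card (factors n) + card B \<le> card (factors (Suc n))" if "n0 \<le> n" for n
  proof -
    let ?P = "(\<lambda>z. map z [0..<n]) ` B"
    have "inj_on (\<lambda>z. map z [0..<n]) B"
    proof (rule inj_onI)
      fix x y assume "x \<in> B" "y \<in> B" "map x [0..<n] = map y [0..<n]"
      moreover from this(3) have "\<forall>i\<in>F. x i = y i" using n0 \<open>n0 \<le> n\<close> by auto
      ultimately show "x = y" using F(2) by blast
    qed
    then have card_P: "card ?P = card B" by (rule card_image)
    have P: "?P \<subseteq> factors n" using B(2) branch_points_subset prefix_in_factors by blast
    have "\<exists>a. a # w \<in> factors (Suc n)" if "w \<in> factors n" for w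
    proof -
      obtain j where w: "w = map (\<lambda>t. u (j + t)) [0..<n]"
        using \<open>w \<in> factors n\<close> by (auto simp: factors_def)
      have "(shift ^^ j) u \<in> one_sided_shift u"
        by (intro shift_funpow_in_one_sided_shift base_in_one_sided_shift)
      then obtain y where y: "y \<in> one_sided_shift u" "shift y = (shift ^^ j) u"
        using shift_surj by blast
      then have "map y [0..<Suc n] = y 0 # w"
        unfolding map_upt_Suc_shift y(2) w by (simp add: shift_funpow_nat add.commute)
      then show ?thesis using prefix_in_factors[OF y(1), of "Suc n"] by auto
    qed
    then obtain a where a: "\<And>w. w \<in> factors n \<Longrightarrow> a w # w \<in> factors (Suc n)" by metis
    have "\<exists>b. b \<noteq> a w \<and> b # w \<in> factors (Suc n)" if w: "w \<in> ?P" for w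
    proof -
      obtain z where z: "z \<in> branch_points" "w = map z [0..<n]" using w B(2) by blast
      then obtain x y where xy: "x \<in> one_sided_shift u" "y \<in> one_sided_shift u"
          "x \<noteq> y" "shift x = z" "shift y = z"
        unfolding branch_points_def by blast
      have "x 0 \<noteq> y 0"
      proof
        assume "x 0 = y 0"
        moreover have "x (Suc k) = y (Suc k)" for k
          using xy(4,5) by (simp add: shift_def fun_eq_iff)
        ultimately have "x k = y k" for k by (cases k) auto
        with xy(3) show False by auto
      qed
      moreover have "x 0 # w \<in> factors (Suc n)" "y 0 # w \<in> factors (Suc n)"
        using prefix_in_factors[OF xy(1), of "Suc n"] prefix_in_factors[OF xy(2), of "Suc n"]
        unfolding map_upt_Suc_shift xy z(2) by auto
      ultimately show ?thesis by metis
    qed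
    then obtain b where b: "\<And>w. w \<in> ?P \<Longrightarrow> b w \<noteq> a w \<and> b w # w \<in> factors (Suc n)" by metis
    let ?A = "(\<lambda>w. a w # w) ` factors n" and ?B = "(\<lambda>w. b w # w) ` ?P"
    have "card (factors n) + card B = card ?A + card ?B"
      using card_P by (simp add: card_image inj_on_def)
    also have "\<dots> = card (?A \<union> ?B)"
    proof (intro card_Un_disjoint[symmetric])
      show "?A \<inter> ?B = {}" using b by force
    qed (use finite_factors B(1) in auto)
    also have "\<dots> \<le> card (factors (Suc n))"
      using a b by (intro card_mono finite_factors) auto
    finally show ?thesis .
  qed
  then show ?thesis by blast
qed

lemma finite_branch_points: "finite branch_points"
proof -
  define c where "c = card (UNIV :: 'a set) ^ 2"
  have bdd: "card B \<le> c" if B: "B \<subseteq> branch_points" "finite B" for B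
  proof (rule ccontr)
    assume "\<not> card B \<le> c"
    then have c: "c + 1 \<le> card B" by simp
    obtain n0 where n0: "\<And>n. n0 \<le> n \<Longrightarrow> card (factors n) + card B \<le> card (factors (Suc n))"
      using card_factors_Suc_ge[OF B(2,1)] by blast
    have growth: "card B * d \<le> card (factors (n0 + d))" for d
    proof (induction d)
      case (Suc d)
      then show ?case using n0[of "n0 + d"] by simp
    qed simp
    \<comment> \<open>Makes r^K exceed (c + 1) * n0, so that d = r^K - n0 exceeds c * n0. Slope at
      least c + 1 from \<open>n0\<close> on and the bound c * r^K would force the opposite.\<close>
    define K where "K = m * ((c + 1) * n0)"
    have "(c + 1) * n0 \<le> K" using m_pos by (simp add: K_def)
    also have "K < 2 ^ K" by (rule less_exp)
    also have "2 ^ K \<le> r ^ K" using r_ge_2 by (rule power_mono) simp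
    finally have K: "(c + 1) * n0 < r ^ K" .
    moreover have "n0 \<le> (c + 1) * n0" by simp
    ultimately obtain d where d: "r ^ K = n0 + d"
      using le_Suc_ex less_imp_le_nat order_trans by metis
    have "(c + 1) * d \<le> card B * d" using c by (rule mult_right_mono) simp
    also have "\<dots> \<le> card (factors (r ^ K))" unfolding d by (rule growth)
    also have "\<dots> \<le> c * r ^ K" unfolding c_def by (rule card_factors_le) (simp add: K_def)
    also have "\<dots> = c * n0 + c * d" by (simp add: d algebra_simps)
    finally have "d \<le> c * n0" by (simp add: algebra_simps)
    with K d show False by (simp add: algebra_simps)
  qed
  show ?thesis using finite_if_finite_subsets_card_bdd[OF bdd] by (rule conjunct1)
qed

text \<open>Either arbitrarily long equal futures in \<open>u\<close> follow different letters, and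
  a limit gives a branch point, or some fixed number of letters determines the preceding one, which
  bounds the complexity.\<close>

lemma branch_points_nonempty:
  assumes inf: "infinite (two_sided_shift u)"
  shows "branch_points \<noteq> {}"
proof (cases "\<forall>n. \<exists>i j. u i \<noteq> u j \<and> (\<forall>k<n. u (Suc i + k) = u (Suc j + k))")
  case True
  then obtain I J where IJ: "\<And>n. u (I n) \<noteq> u (J n)"
      "\<And>n k. k < n \<Longrightarrow> u (Suc (I n) + k) = u (Suc (J n) + k)" by metis
  \<comment> \<open>Working with pairs makes both limits come from the same indices.\<close>
  obtain p where p: "\<And>l. infinite {n. \<forall>k<l. (u (I n + k), u (J n + k)) = p k}"
    using infinitely_often_prefix[of "\<lambda>n k. (u (I n + k), u (J n + k))"] by blast
  \<comment> \<open>The index must also be large, since the futures at \<open>I n\<close> and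
    \<open>J n\<close> are known to agree only for \<open>n\<close> letters.\<close>
  have approx: "\<exists>n\<ge>l. \<forall>k<l. u (I n + k) = fst (p k) \<and> u (J n + k) = snd (p k)" for l
  proof -
    obtain n where "n \<ge> l" "\<forall>k<l. (u (I n + k), u (J n + k)) = p k"
      using p[of l] unfolding infinite_nat_iff_unbounded_le by blast
    then show ?thesis by (intro exI[of _ n]) (auto simp: prod_eq_iff)
  qed
  let ?x = "\<lambda>k. fst (p k)" and ?y = "\<lambda>k. snd (p k)"
  have "?x \<in> one_sided_shift u"
    unfolding one_sided_shift_iff
  proof
    fix l
    obtain n where "\<forall>k<l. u (I n + k) = fst (p k)" using approx[of l] by blast
    then show "\<exists>j. \<forall>k<l. fst (p k) = u (j + k)" by (intro exI[of _ "I n"]) simp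
  qed
  moreover have "?y \<in> one_sided_shift u"
    unfolding one_sided_shift_iff
  proof
    fix l
    obtain n where "\<forall>k<l. u (J n + k) = snd (p k)" using approx[of l] by blast
    then show "\<exists>j. \<forall>k<l. snd (p k) = u (j + k)" by (intro exI[of _ "J n"]) simp
  qed
  moreover have "?x \<noteq> ?y"
  proof
    assume "?x = ?y"
    then have "fst (p 0) = snd (p 0)" by (rule fun_cong)
    moreover obtain n where "u (I n + 0) = fst (p 0)" "u (J n + 0) = snd (p 0)"
      using approx[of 1] by auto
    ultimately show False using IJ(1)[of n] by simp
  qed
  moreover have "shift ?x = shift ?y"
  proof
    fix k
    obtain n where "n \<ge> Suc (Suc k)"
        "u (I n + Suc k) = fst (p (Suc k))" "u (J n + Suc k) = snd (p (Suc k))"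
      using approx[of "Suc (Suc k)"] by auto
    then show "shift ?x k = shift ?y k" using IJ(2)[of k n] by (simp add: shift_def)
  qed
  ultimately show ?thesis unfolding branch_points_def by blast
next
  case False
  then obtain n where "\<forall>i j. \<not> (u i \<noteq> u j \<and> (\<forall>k<n. u (Suc i + k) = u (Suc j + k)))"
    by (simp only: not_all not_ex) (elim exE)
  then have n: "u i = u j" if "\<forall>k<n. u (Suc i + k) = u (Suc j + k)" for i j
    using that by metis
  \<comment> \<open>Deleting the first letter is injective on words longer than \<open>n\<close>, so
    the complexity cannot grow from \<open>n\<close> on.\<close>
  have le: "card (factors (n + d)) \<le> card (factors n)" for d
  proof (induction d)
    case (Suc d)
    have Cons: "map (\<lambda>t. u (j + t)) [0..<Suc (n + d)] = u j # map (\<lambda>t. u (Suc j + t)) [0..<n + d]"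
      for j by (simp add: map_upt_Suc del: upt_Suc)
    have factor_cases: "\<exists>j. v = u j # map (\<lambda>t. u (Suc j + t)) [0..<n + d]"
      if "v \<in> factors (Suc (n + d))" for v
    proof -
      obtain j where "v = map (\<lambda>t. u (j + t)) [0..<Suc (n + d)]"
        using \<open>v \<in> factors (Suc (n + d))\<close> unfolding factors_def by (elim rangeE)
      then have "v = u j # map (\<lambda>t. u (Suc j + t)) [0..<n + d]" by (simp only: Cons)
      then show ?thesis by (rule exI)
    qed
    have "inj_on tl (factors (Suc (n + d)))"
    proof (rule inj_onI)
      fix v w
      assume vw: "v \<in> factors (Suc (n + d))" "w \<in> factors (Suc (n + d))" and tl: "tl v = tl w"
      then obtain i j where
        v: "v = u i # map (\<lambda>t. u (Suc i + t)) [0..<n + d]" and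
        w: "w = u j # map (\<lambda>t. u (Suc j + t)) [0..<n + d]"
        using factor_cases[OF vw(1)] factor_cases[OF vw(2)] by (elim exE)
      have "map (\<lambda>t. u (Suc i + t)) [0..<n + d] = map (\<lambda>t. u (Suc j + t)) [0..<n + d]"
        using tl by (simp only: v w list.sel)
      then have "\<forall>t<n. u (Suc i + t) = u (Suc j + t)" by simp
      then have "u i = u j" by (rule n)
      then show "v = w" using tl v w by simp
    qed
    moreover have "tl ` factors (Suc (n + d)) \<subseteq> factors (n + d)"
    proof (rule image_subsetI)
      fix v assume "v \<in> factors (Suc (n + d))"
      then obtain j where "v = u j # map (\<lambda>t. u (Suc j + t)) [0..<n + d]"
        using factor_cases[OF \<open>v \<in> factors (Suc (n + d))\<close>] by (elim exE)
      then have "tl v = map (\<lambda>t. u (Suc j + t)) [0..<n + d]" by (simp only: list.sel)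
      then show "tl v \<in> factors (n + d)" unfolding factors_def by (rule range_eqI)
    qed
    ultimately have "card (factors (Suc (n + d))) \<le> card (factors (n + d))"
      using finite_factors by (intro card_inj_on_le)
    with Suc show ?case by simp
  qed simp
  have bdd: "card Y \<le> card (factors n)" if Y: "Y \<subseteq> two_sided_shift u" "finite Y" for Y
  proof -
    obtain F where F: "finite F" "\<And>x y. x \<in> Y \<Longrightarrow> y \<in> Y \<Longrightarrow> (\<forall>i\<in>F. x i = y i) \<Longrightarrow> x = y"
      using finite_functions_separated[OF Y(2)] by blast
    obtain N where N: "\<And>i. i \<in> F \<Longrightarrow> \<bar>i\<bar> < int N"
      using finite_int_abs_bounded[OF F(1)] by blast
    \<comment> \<open>Coordinates of absolute value below \<open>N\<close> sit at positions below 2N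
      of this word; the additional \<open>n\<close> letters bring its length into the range of
      \<open>le\<close>.\<close>
    let ?w = "\<lambda>x. map (tail (- int N) x) [0..<n + 2 * N]"
    have "inj_on ?w Y"
    proof (rule inj_onI)
      fix x y assume "x \<in> Y" "y \<in> Y" "?w x = ?w y"
      moreover have "x i = y i" if "i \<in> F" for i
      proof -
        have "0 \<le> i + int N" "nat (i + int N) < n + 2 * N" using N[OF that] by linarith+
        moreover have "\<forall>t<n + 2 * N. tail (- int N) x t = tail (- int N) y t"
          using \<open>?w x = ?w y\<close> by simp
        ultimately have "tail (- int N) x (nat (i + int N)) = tail (- int N) y (nat (i + int N))"
          by blast
        then show ?thesis using \<open>0 \<le> i + int N\<close> by (simp add: tail_def)
      qed
      ultimately show "x = y" using F(2) by blast
    qed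
    moreover have "?w ` Y \<subseteq> factors (n + 2 * N)"
      using Y(1) by (auto simp: two_sided_shift_iff intro!: prefix_in_factors)
    ultimately have "card Y \<le> card (factors (n + 2 * N))"
      using finite_factors by (intro card_inj_on_le)
    then show ?thesis using le[of "2 * N"] by simp
  qed
  have "finite (two_sided_shift u)"
    using finite_if_finite_subsets_card_bdd[OF bdd] by (rule conjunct1)
  with inf show ?thesis by contradiction
qed

lemma two_sided_shift_nonempty: "two_sided_shift u \<noteq> {}"
  using two_sided_extension[OF base_in_one_sided_shift] by blast

end

section \<open>Factor maps onto the \<open>r\<close>-adic integers\<close>

locale adic_primitive_fixed_point = primitive_fixed_point r \<theta> u m
  for r \<theta> and u :: "nat \<Rightarrow> 'a::{finite,discrete_topology}" and m +
  fixes \<pi> :: "(int \<Rightarrow> 'a) \<Rightarrow> nat \<Rightarrow> nat"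
  assumes factor_map: "adic_factor_map r (two_sided_shift u) shift \<pi>"
begin

abbreviation "X \<equiv> two_sided_shift u"

lemma pi_in_adic_ints: "x \<in> X \<Longrightarrow> \<pi> x \<in> adic_ints r"
  and continuous_pi: "continuous_on X \<pi>"
  and pi_shift: "x \<in> X \<Longrightarrow> \<pi> (shift x) = adic_add r (\<pi> x) (adic_one r)"
  using factor_map by (auto simp: adic_factor_map_def)

lemma pi_shift_funpow:
  assumes "x \<in> X"
  shows "\<pi> ((shift ^^ p) x) n = (\<pi> x n + p) mod r ^ n"
proof (induction p)
  case 0
  have "\<pi> x n < r ^ n" using pi_in_adic_ints[OF assms] by (simp add: adic_ints_def)
  then show ?case by simp
next
  case (Suc p)
  then show ?case
    using assms by (simp add: pi_shift shift_funpow_in_two_sided_shift adic_add_def adic_one_def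
        mod_simps)
qed

text \<open>The difference of \<pi>(\<Phi> x) and \<pi>(x) is constant along one orbit. That orbit
  is dense and each residue is locally constant, so the difference is the same everywhere.\<close>

lemma pi_translation:
  assumes \<Phi>: "\<Phi> \<in> Aut X shift"
  shows "\<exists>z\<in>adic_ints r. \<forall>x\<in>X. \<pi> (\<Phi> x) = adic_add r z (\<pi> x)"
proof -
  obtain x0 where x0: "x0 \<in> X" using two_sided_shift_nonempty by blast
  obtain z where z: "z \<in> adic_ints r" "adic_add r z (\<pi> x0) = \<pi> (\<Phi> x0)"
    using adic_difference[OF pi_in_adic_ints[OF AutD(5)[OF \<Phi> x0]] pi_in_adic_ints[OF x0] r_pos]
    by blast
  have "\<pi> (\<Phi> x) n = adic_add r z (\<pi> x) n" if x: "x \<in> X" for x n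
  proof -
    have "continuous_on X (\<lambda>x. \<pi> (\<Phi> x))"
      using continuous_pi AutD(2,3)[OF \<Phi>] by (intro continuous_on_compose2[of X \<pi> X \<Phi>]) auto
    then obtain F where F: "finite F"
        "\<And>y. y \<in> X \<Longrightarrow> (\<forall>i\<in>F. y i = x i) \<Longrightarrow> \<pi> (\<Phi> y) n = \<pi> (\<Phi> x) n"
      using continuous_on_coordinate_determined[of X "\<lambda>x. \<pi> (\<Phi> x)" x n] x by blast
    obtain F' where F': "finite F'" "\<And>y. y \<in> X \<Longrightarrow> (\<forall>i\<in>F'. y i = x i) \<Longrightarrow> \<pi> y n = \<pi> x n"
      using continuous_on_coordinate_determined[OF continuous_pi x, of n] by blast
    obtain G where "\<And>y q. y \<in> X \<Longrightarrow> \<exists>p<G. \<forall>i\<in>F \<union> F'. y (q + int p + i) = x i"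
      using two_sided_minimal[OF x, of "F \<union> F'"] F(1) F'(1) by blast
    \<comment> \<open>At time \<open>p\<close> the orbit of \<open>x0\<close> agrees with
      \<open>x\<close> on the coordinates that decide both level-n residues.\<close>
    from this[OF x0, of 0] obtain p where p: "\<forall>i\<in>F \<union> F'. (shift ^^ p) x0 i = x i"
      by (auto simp: shift_funpow_int add.commute)
    have px0: "(shift ^^ p) x0 \<in> X" using x0 by (rule shift_funpow_in_two_sided_shift)
    have "\<pi> (\<Phi> x) n = \<pi> (\<Phi> ((shift ^^ p) x0)) n" using F(2)[OF px0] p by simp
    also have "\<Phi> ((shift ^^ p) x0) = (shift ^^ p) (\<Phi> x0)"
      using AutD(6)[OF \<Phi>] shift_in_two_sided_shift x0 by (rule Aut_shift_funpow)
    also have "\<pi> \<dots> n = (\<pi> (\<Phi> x0) n + p) mod r ^ n"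
      using AutD(5)[OF \<Phi> x0] by (rule pi_shift_funpow)
    also have "\<dots> = (z n + (\<pi> x0 n + p) mod r ^ n) mod r ^ n"
      by (simp add: z(2)[symmetric] adic_add_def mod_simps add.assoc)
    also have "(\<pi> x0 n + p) mod r ^ n = \<pi> ((shift ^^ p) x0) n"
      using pi_shift_funpow[OF x0] by simp
    also have "\<dots> = \<pi> x n" using F'(2)[OF px0] p by simp
    finally show ?thesis by (simp add: adic_add_def)
  qed
  with z(1) show ?thesis by (intro bexI[of _ z]) auto
qed

lemma kappa_eqI:
  assumes "z \<in> adic_ints r" "\<forall>x\<in>X. \<pi> (\<Phi> x) = adic_add r z (\<pi> x)"
  shows "kappa r X \<pi> \<Phi> = z"
  unfolding kappa_def
proof (rule the_equality)
  fix z' assume z': "z' \<in> adic_ints r \<and> (\<forall>x\<in>X. \<pi> (\<Phi> x) = adic_add r z' (\<pi> x))"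
  obtain x where "x \<in> X" using two_sided_shift_nonempty by blast
  then show "z' = z" using adic_add_cancel[of z' r z "\<pi> x"] assms z' by auto
qed (use assms in auto)

lemma kappa_spec:
  assumes "\<Phi> \<in> Aut X shift"
  shows "kappa r X \<pi> \<Phi> \<in> adic_ints r"
    and "x \<in> X \<Longrightarrow> \<pi> (\<Phi> x) = adic_add r (kappa r X \<pi> \<Phi>) (\<pi> x)"
  using pi_translation[OF assms] kappa_eqI by auto

section \<open>One-sided automorphisms\<close>

text \<open>A map commuting with the one-sided shift looks only to the right, so it can be applied
  at every integer position.\<close>

definition two_sided_lift :: "((nat \<Rightarrow> 'a) \<Rightarrow> nat \<Rightarrow> 'a) \<Rightarrow> (int \<Rightarrow> 'a) \<Rightarrow> int \<Rightarrow> 'a" where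
  "two_sided_lift f = restrict (\<lambda>x i. f (tail i x) 0) X"

lemma tail_two_sided_lift:
  assumes "\<And>y. y \<in> one_sided_shift u \<Longrightarrow> f (shift y) = shift (f y)" "x \<in> X"
  shows "tail i (two_sided_lift f x) = f (tail i x)"
proof
  fix n
  have t: "tail i x \<in> one_sided_shift u" using assms(2) by (simp add: two_sided_shift_iff)
  have "(shift ^^ n) (tail i x) = tail (i + int n) x"
    by (auto simp: shift_funpow_nat tail_def add.assoc add.commute[of "int n"])
  moreover have "f ((shift ^^ n) (tail i x)) = (shift ^^ n) (f (tail i x))"
    using assms(1) shift_in_one_sided_shift t by (rule Aut_shift_funpow)
  moreover have "two_sided_lift f x j = f (tail j x) 0" for j
    using assms(2) by (simp add: two_sided_lift_def)
  ultimately have "two_sided_lift f x (i + int n) = f (tail i x) n" by (simp add: shift_funpow_nat)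
  then show "tail i (two_sided_lift f x) n = f (tail i x) n" by (simp only: tail_def)
qed

lemma continuous_on_tail: "continuous_on A (tail i)"
  unfolding tail_def
  by (intro continuous_on_coordinatewise_then_product)
    (rule continuous_on_subset[OF continuous_on_product_coordinates], simp)

lemma tail_eqI: "(\<And>i. tail i x = tail i y) \<Longrightarrow> x = y"
proof
  fix i assume "\<And>i. tail i x = tail i y"
  then have "tail i x 0 = tail i y 0" by simp
  then show "x i = y i" by (simp add: tail_def)
qed

text \<open>The inverse of the lift is the lift of the inverse \<open>g\<close>, which also commutes
  with the shift. The identities are checked on all tails.\<close>

lemma two_sided_lift_in_Aut:
  assumes f: "f \<in> Aut (one_sided_shift u) shift"
  shows "two_sided_lift f \<in> Aut X shift"
proof -
  let ?Y = "one_sided_shift u"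
  obtain g where h: "homeomorphism ?Y ?Y f g" using f by (auto simp: Aut_def)
  have f_shift: "f (shift y) = shift (f y)" if "y \<in> ?Y" for y using AutD(6)[OF f that] .
  have f_Y: "f y \<in> ?Y" and g_Y: "g y \<in> ?Y" and gf: "g (f y) = y" and fg: "f (g y) = y"
    if "y \<in> ?Y" for y
    using h that unfolding homeomorphism_def by blast+
  have cf: "continuous_on ?Y f" and cg: "continuous_on ?Y g"
    using h unfolding homeomorphism_def by blast+
  have g_shift: "g (shift y) = shift (g y)" if y: "y \<in> ?Y" for y
  proof -
    have "shift y = f (shift (g y))" using f_shift[OF g_Y[OF y]] fg[OF y] by simp
    then show ?thesis using gf[OF shift_in_one_sided_shift[OF g_Y[OF y]]] by simp
  qed
  have cont: "continuous_on X (two_sided_lift k)" if "continuous_on ?Y k" for k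
  proof (rule continuous_on_coordinatewise_then_product)
    fix i
    have "continuous_on X (\<lambda>x. k (tail i x))"
      using that continuous_on_tail
      by (rule continuous_on_compose2) (auto simp: two_sided_shift_iff)
    then have "continuous_on X (\<lambda>x. k (tail i x) 0)"
      by (rule continuous_on_product_then_coordinatewise)
    then show "continuous_on X (\<lambda>x. two_sided_lift k x i)"
      by (rule continuous_on_eq) (simp add: two_sided_lift_def)
  qed
  have lift_f: "tail i (two_sided_lift f x) = f (tail i x)" if "x \<in> X" for x i
    using f_shift that by (rule tail_two_sided_lift)
  have lift_g: "tail i (two_sided_lift g x) = g (tail i x)" if "x \<in> X" for x i
    using g_shift that by (rule tail_two_sided_lift)
  have f_X: "two_sided_lift f x \<in> X" if "x \<in> X" for x
    using f_Y lift_f[OF that] that by (simp add: two_sided_shift_iff)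
  have g_X: "two_sided_lift g x \<in> X" if "x \<in> X" for x
    using g_Y lift_g[OF that] that by (simp add: two_sided_shift_iff)
  have "homeomorphism X X (two_sided_lift f) (two_sided_lift g)"
  proof (rule homeomorphismI)
    fix x assume x: "x \<in> X"
    then have t: "tail i x \<in> ?Y" for i by (simp add: two_sided_shift_iff)
    show "two_sided_lift g (two_sided_lift f x) = x"
      by (rule tail_eqI) (simp add: lift_g f_X lift_f x gf t)
    show "two_sided_lift f (two_sided_lift g x) = x"
      by (rule tail_eqI) (simp add: lift_g g_X lift_f x fg t)
  qed (use cont[OF cf] cont[OF cg] f_X g_X in auto)
  moreover have "two_sided_lift f (shift x) = shift (two_sided_lift f x)" if "x \<in> X" for x
    by (rule tail_eqI) (simp add: tail_shift lift_f that shift_in_two_sided_shift[OF that])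
  moreover have "two_sided_lift f \<in> extensional X" by (simp add: two_sided_lift_def)
  ultimately show ?thesis by (auto simp: Aut_def)
qed

lemma one_sided_Aut_finite_order:
  assumes inf: "infinite X" and f: "f \<in> Aut (one_sided_shift u) shift"
  shows "\<exists>N>0. \<forall>x\<in>one_sided_shift u. (f ^^ N) x = x"
proof -
  let ?Y = "one_sided_shift u"
  have f_in: "(f ^^ n) x \<in> ?Y" if "x \<in> ?Y" for n x
    using that by (induction n) (auto simp: AutD(5)[OF f])
  have f_inj: "inj_on (f ^^ n) ?Y" for n
  proof (induction n)
    case (Suc n)
    have "(f ^^ n) ` ?Y \<subseteq> ?Y" using f_in by blast
    then have "inj_on (f \<circ> f ^^ n) ?Y"
      by (intro comp_inj_on Suc inj_on_subset[OF AutD(4)[OF f]])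
    then show ?case by (simp only: funpow.simps(2))
  qed simp
  \<comment> \<open>Injectivity keeps the images of the two preimages distinct.\<close>
  have f_branch: "f z \<in> branch_points" if z: "z \<in> branch_points" for z
  proof -
    obtain x y where xy: "x \<in> ?Y" "y \<in> ?Y" "x \<noteq> y" "shift x = z" "shift y = z"
      using z unfolding branch_points_def by blast
    have "f x \<in> ?Y" "f y \<in> ?Y" using xy(1,2) by (auto simp: AutD(5)[OF f])
    moreover have "f x \<noteq> f y" using xy(1-3) inj_onD[OF AutD(4)[OF f]] by blast
    moreover have "shift (f x) = f z" "shift (f y) = f z"
      using AutD(6)[OF f xy(1)] AutD(6)[OF f xy(2)] xy(4,5) by simp_all
    ultimately show ?thesis unfolding branch_points_def by blast
  qed
  obtain b where b: "b \<in> branch_points" using branch_points_nonempty[OF inf] by blast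
  then have bY: "b \<in> ?Y" using branch_points_subset by blast
  have "(f ^^ n) b \<in> branch_points" for n by (induction n) (auto simp: b f_branch)
  then have "finite (range (\<lambda>n. (f ^^ n) b))"
    by (intro finite_subset[OF _ finite_branch_points] image_subsetI)
  then have "\<not> inj (\<lambda>n. (f ^^ n) b)" using finite_imageD infinite_UNIV_nat by blast
  then obtain i j where ij: "i < j" "(f ^^ i) b = (f ^^ j) b"
    unfolding inj_def by (metis linorder_neqE_nat)
  define N where "N = j - i"
  have "j = i + N" using ij(1) by (simp add: N_def)
  \<comment> \<open>A repetition in the orbit of \<open>b\<close> alone gives eventual periodicity;
    cancelling the injective \<open>f ^^ i\<close> makes \<open>b\<close> itself periodic.\<close>
  then have "(f ^^ i) ((f ^^ N) b) = (f ^^ i) b" using ij(2) by (simp only: funpow_add o_apply)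
  then have fixb: "(f ^^ N) b = b"
    using f_in[OF bY] bY by (rule inj_onD[OF f_inj])
  have f_comm: "(f ^^ N) (shift x) = shift ((f ^^ N) x)" if "x \<in> ?Y" for x
    using that f_in by (induction N) (auto simp: AutD(6)[OF f])
  have cont: "continuous_on ?Y (f ^^ n)" for n
  proof (induction n)
    case (Suc n)
    have "(f ^^ n) ` ?Y \<subseteq> ?Y" using f_in by blast
    then have "continuous_on ?Y (\<lambda>x. f ((f ^^ n) x))"
      using continuous_on_compose2[OF AutD(2)[OF f] Suc] by blast
    then show ?case by (simp add: o_def)
  qed (simp add: id_def)
  \<comment> \<open>The iterate fixes the whole orbit of \<open>b\<close>, which approaches
    \<open>x\<close>; continuity then fixes coordinate \<open>k\<close>.\<close>
  have "(f ^^ N) x k = x k" if x: "x \<in> ?Y" for x k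
  proof -
    obtain F where F: "finite F"
        "\<And>y. y \<in> ?Y \<Longrightarrow> (\<forall>i\<in>F. y i = x i) \<Longrightarrow> (f ^^ N) y k = (f ^^ N) x k"
      using continuous_on_coordinate_determined[OF cont x, of N k] by blast
    obtain n where n: "insert k F \<subseteq> {..<n}"
      using F(1) finite_nat_iff_bounded finite_insert by metis
    obtain p where "\<forall>t<n. b (p + t) = x t" using one_sided_minimal[OF x, of n] bY by blast
    then have p: "(shift ^^ p) b t = x t" if "t < n" for t
      using that by (simp add: shift_funpow_nat add.commute[of t])
    have "(f ^^ N) ((shift ^^ p) b) = (shift ^^ p) ((f ^^ N) b)"
      using f_comm shift_in_one_sided_shift bY by (rule Aut_shift_funpow)
    moreover have "(f ^^ N) ((shift ^^ p) b) k = (f ^^ N) x k"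
      using p n bY by (intro F(2)) (auto simp: shift_funpow_in_one_sided_shift)
    ultimately show ?thesis using p[of k] n fixb by simp
  qed
  then have "\<forall>x\<in>?Y. (f ^^ N) x = x" by auto
  moreover have "0 < N" using ij(1) by (simp add: N_def)
  ultimately show ?thesis by blast
qed

lemma kappa_restrict_id: "kappa r X \<pi> (restrict id X) = (\<lambda>_. 0)"
proof (rule kappa_eqI)
  show "(\<lambda>_. 0) \<in> adic_ints r" using r_pos by (simp add: adic_ints_def)
  have "\<pi> x = adic_add r (\<lambda>_. 0) (\<pi> x)" if "x \<in> X" for x
    using pi_in_adic_ints[OF that] by (auto simp: adic_add_def adic_ints_def)
  then show "\<forall>x\<in>X. \<pi> (restrict id X x) = adic_add r (\<lambda>_. 0) (\<pi> x)" by simp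
qed

lemma kappa_finite_order:
  assumes \<Phi>: "\<Phi> \<in> Aut X shift" and N: "0 < N" "\<forall>x\<in>X. (\<Phi> ^^ N) x = x"
  shows "kappa r X \<pi> \<Phi> = (\<lambda>_. 0)"
proof -
  let ?z = "kappa r X \<pi> \<Phi>"
  obtain x where x: "x \<in> X" using two_sided_shift_nonempty by blast
  have in_X: "(\<Phi> ^^ l) x \<in> X" for l using x by (induction l) (auto simp: AutD(5)[OF \<Phi>])
  have lt: "\<pi> x n < r ^ n" for n using pi_in_adic_ints[OF x] by (simp add: adic_ints_def)
  \<comment> \<open>Each application of \<open>\<Phi>\<close> adds \<open>?z\<close> to the value of
    \<pi>, so the return after \<open>N\<close> steps gives N * \<open>?z\<close> = 0 at every
    level.\<close>
  have power: "\<pi> ((\<Phi> ^^ l) x) n = (l * ?z n + \<pi> x n) mod r ^ n" for l n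
  proof (induction l)
    case (Suc l)
    have "\<pi> ((\<Phi> ^^ Suc l) x) n = (?z n + \<pi> ((\<Phi> ^^ l) x) n) mod r ^ n"
      using kappa_spec(2)[OF \<Phi> in_X] by (simp add: adic_add_def)
    also have "\<dots> = (?z n + (l * ?z n + \<pi> x n)) mod r ^ n" by (simp only: Suc mod_add_right_eq)
    finally show ?case by (simp only: mult_Suc add.assoc)
  qed (simp add: lt)
  have "r ^ n dvd N * ?z n" for n
  proof -
    have "(N * ?z n + \<pi> x n) mod r ^ n = \<pi> x n mod r ^ n"
      using power[of N n] N(2)[rule_format, OF x] lt[of n] by simp
    then have "int (N * ?z n + \<pi> x n) mod int (r ^ n) = int (\<pi> x n) mod int (r ^ n)"
      by (simp only: zmod_int[symmetric])
    then have "int (r ^ n) dvd int (N * ?z n)"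
      by (simp add: mod_eq_dvd_iff del: of_nat_power of_nat_mult)
    then show ?thesis by (simp only: int_dvd_int_iff)
  qed
  then have "?z n = 0" for n by (rule adic_torsion_free[OF kappa_spec(1)[OF \<Phi>] N(1) _ r_pos])
  then show ?thesis by (rule ext)
qed

lemma one_sided_Aut_trivial:
  assumes inf: "infinite X" and inj: "inj_on (kappa r X \<pi>) (Aut X shift)"
  shows "Aut (one_sided_shift u) shift = {restrict id (one_sided_shift u)}"
proof -
  let ?Y = "one_sided_shift u"
  have "f = restrict id ?Y" if f: "f \<in> Aut ?Y shift" for f
  proof -
    let ?\<Phi> = "two_sided_lift f"
    have \<Phi>: "?\<Phi> \<in> Aut X shift" using f by (rule two_sided_lift_in_Aut)
    have tail_lift: "tail i (?\<Phi> x) = f (tail i x)" if "x \<in> X" for x i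
      using AutD(6)[OF f] that by (rule tail_two_sided_lift)
    obtain N where N: "0 < N" "\<And>x. x \<in> ?Y \<Longrightarrow> (f ^^ N) x = x"
      using one_sided_Aut_finite_order[OF inf f] by blast
    have "(?\<Phi> ^^ N) x = x" if x: "x \<in> X" for x
    proof (rule tail_eqI)
      fix i
      have "(?\<Phi> ^^ n) x \<in> X \<and> tail i ((?\<Phi> ^^ n) x) = (f ^^ n) (tail i x)" for n
        using x by (induction n) (auto simp: AutD(5)[OF \<Phi>] tail_lift)
      then show "tail i ((?\<Phi> ^^ N) x) = tail i x"
        using N(2) x by (simp add: two_sided_shift_iff)
    qed
    then have "kappa r X \<pi> ?\<Phi> = kappa r X \<pi> (restrict id X)"
      using kappa_finite_order[OF \<Phi> N(1)] kappa_restrict_id by simp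
    moreover have "restrict id X \<in> Aut X shift"
      using shift_in_two_sided_shift by (rule restrict_id_in_Aut)
    ultimately have \<Phi>_id: "?\<Phi> = restrict id X"
      using inj_onD[OF inj] \<Phi> by blast
    show ?thesis
    proof (rule extensionalityI[of _ ?Y])
      fix y assume "y \<in> ?Y"
      \<comment> \<open>Every one-sided point is the right half of a two-sided one, so triviality of
        the lift descends to \<open>f\<close>.\<close>
      then obtain x where "x \<in> X" "tail 0 x = y" using two_sided_extension by blast
      then have "f y = y" using tail_lift[of x 0] \<Phi>_id by simp
      then show "f y = restrict id ?Y y" using \<open>y \<in> ?Y\<close> by simp
    qed (use AutD(1)[OF f] in simp_all)
  qed
  moreover have "restrict id ?Y \<in> Aut ?Y shift"
    using shift_in_one_sided_shift by (rule restrict_id_in_Aut)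
  ultimately show ?thesis by blast
qed

section \<open>Coincidences\<close>

text \<open>If all words \<theta>^k(a) have the same letter c at \<open>s\<close>, then all words
  \<theta>^(j+k)(a) contain \<theta>^j(c) from s * r^j on: one common letter swells to a common
  stretch of length r^j.\<close>

lemma coincidence_block:
  assumes "has_coincidence r \<theta>"
  shows "\<exists>K s. m dvd K \<and> s + L \<le> r ^ K \<and> (\<forall>a b n. s \<le> n \<longrightarrow> n < s + L \<longrightarrow>
           (S ^^ K) (\<lambda>_. a) n = (S ^^ K) (\<lambda>_. b) n)"
proof -
  obtain k s where k: "s < r ^ k" "\<And>a b. (S ^^ k) (\<lambda>_. a) s = (S ^^ k) (\<lambda>_. b) s"
    using coincidence_iterate[OF r_pos assms] by blast
  \<comment> \<open>A multiple of m leaving j = K - k at least \<open>L\<close>, hence r^j >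
    \<open>L\<close>.\<close>
  define K where "K = m * (k + L)"
  define j where "j = K - k"
  have "k + L \<le> K" using m_pos by (simp add: K_def)
  then have K: "K = j + k" and "L \<le> j" by (auto simp: j_def)
  have "L < r ^ L" using less_exp[of L] power_mono[of 2 r L] r_ge_2 by linarith
  also have "r ^ L \<le> r ^ j" using \<open>L \<le> j\<close> r_pos by (intro power_increasing) auto
  finally have L: "L < r ^ j" .
  have "(S ^^ K) (\<lambda>_. a) n = (S ^^ K) (\<lambda>_. b) n" if "s * r ^ j \<le> n" "n < s * r ^ j + L" for a b n
  proof -
    have div: "n div r ^ j = s" using that L by (intro div_nat_eqI) (auto simp: mult.commute)
    have eq: "(S ^^ K) (\<lambda>_. c) n = (S ^^ j) (\<lambda>_. (S ^^ k) (\<lambda>_. c) s) n" for c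
      unfolding K funpow_add o_apply by (subst subst_seq_funpow_block) (simp only: div)
    show ?thesis using k(2)[of a b] by (simp only: eq)
  qed
  moreover have "s * r ^ j + L \<le> r ^ K"
  proof -
    have "s * r ^ j + L \<le> Suc s * r ^ j" using L by simp
    also have "\<dots> \<le> r ^ k * r ^ j" using k(1) by (intro mult_right_mono) auto
    finally show ?thesis by (simp add: K power_add mult.commute)
  qed
  moreover have "m dvd K" by (simp add: K_def)
  ultimately show ?thesis by blast
qed

text \<open>Any factor map to \<open>\<int>\<^sub>r\<close> determines the position of the blocks of level \<open>K\<close> modulo \<open>r\<^sup>K\<close>:
  along the orbit of a two-sided extension of \<open>u\<close>, both grow by one at each step.  Hence
  recognizability of \<open>\<theta>\<close> is not needed.\<close>

lemma pi_eq_imp_agree_on_window: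
  assumes co: "has_coincidence r \<theta>" and x: "x \<in> X" and y: "y \<in> X" and eq: "\<pi> x = \<pi> y"
  shows "\<exists>q. \<forall>t<L. x (q + int t) = y (q + int t)"
proof -
  obtain K s where K: "m dvd K" "s + L \<le> r ^ K" "\<forall>a b n. s \<le> n \<longrightarrow> n < s + L \<longrightarrow>
           (S ^^ K) (\<lambda>_. a) n = (S ^^ K) (\<lambda>_. b) n"
    using coincidence_block[OF co, of L] by (elim exE conjE)
  let ?R = "r ^ K"
  obtain x0 where x0: "x0 \<in> X" "tail 0 x0 = u"
    using two_sided_extension[OF base_in_one_sided_shift] by blast
  \<comment> \<open>A window of two blocks always contains a complete block of level
    \<open>K\<close>; the same time \<open>p\<close> records where it begins and the value of \<pi>
    modulo r^K.\<close>
  have approx: "\<exists>p. (\<pi> x0 K + p) mod ?R = \<pi> w K \<and> (\<forall>n<2 * ?R. w (int n) = u (n + p))"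
    if w: "w \<in> X" for w
  proof -
    obtain F where F: "finite F" "\<And>v. v \<in> X \<Longrightarrow> (\<forall>i\<in>F. v i = w i) \<Longrightarrow> \<pi> v K = \<pi> w K"
      using continuous_on_coordinate_determined[OF continuous_pi w, of K] by blast
    let ?F = "F \<union> int ` {..<2 * ?R}"
    obtain G where "\<And>v q. v \<in> X \<Longrightarrow> \<exists>p<G. \<forall>i\<in>?F. v (q + int p + i) = w i"
      using two_sided_minimal[OF w, of ?F] F(1) by blast
    from this[OF x0(1), of 0] obtain p where p: "\<forall>i\<in>?F. (shift ^^ p) x0 i = w i"
      by (auto simp: shift_funpow_int add.commute)
    have "\<pi> ((shift ^^ p) x0) K = \<pi> w K"
      using p x0(1) by (intro F(2)) (auto simp: shift_funpow_in_two_sided_shift)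
    moreover have "w (int n) = u (n + p)" if "n < 2 * ?R" for n
    proof -
      have "w (int n) = (shift ^^ p) x0 (int n)" using p that by auto
      also have "\<dots> = tail 0 x0 (n + p)" by (simp add: tail_def shift_funpow_int)
      finally show ?thesis by (simp only: x0(2))
    qed
    ultimately show ?thesis
      unfolding pi_shift_funpow[OF x0(1)] by (intro exI[of _ p] conjI allI impI)
  qed
  obtain p where p: "(\<pi> x0 K + p) mod ?R = \<pi> x K" "\<And>n. n < 2 * ?R \<Longrightarrow> x (int n) = u (n + p)"
    using approx[OF x] by blast
  obtain p' where p': "(\<pi> x0 K + p') mod ?R = \<pi> y K" "\<And>n. n < 2 * ?R \<Longrightarrow> y (int n) = u (n + p')"
    using approx[OF y] by blast
  have "int (\<pi> x0 K + p) mod int ?R = int (\<pi> x0 K + p') mod int ?R"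
    using p(1) p'(1) eq by (simp only: zmod_int[symmetric])
  then have "int p mod int ?R = int p' mod int ?R" by (simp add: mod_eq_dvd_iff del: of_nat_power)
  then have pp': "p mod ?R = p' mod ?R" by (simp only: zmod_int[symmetric] of_nat_eq_iff)
  \<comment> \<open>R - p mod R is the first positive position of a block boundary in
    \<open>x\<close>, and \<open>s\<close> leads on to the common stretch. As p and p' are
    congruent, the same \<open>n0\<close> serves \<open>y\<close>; s + L \<le> R keeps the stretch
    within 2R.\<close>
  define n0 where "n0 = s + (?R - p mod ?R)"
  have u_eq: "u (n0 + t + q) = (S ^^ K) (\<lambda>_. u ((n0 + t + q) div ?R)) (s + t)"
    if "q mod ?R = p mod ?R" for t q
  proof -
    have "n0 + t + q = s + t + ((?R - q mod ?R) + q)" using that by (simp add: n0_def)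
    also have "(?R - q mod ?R) + q = ?R * Suc (q div ?R)"
    proof -
      have "q mod ?R \<le> ?R" using r_pos by (intro less_imp_le_nat mod_less_divisor) simp
      moreover have "?R * (q div ?R) + q mod ?R = q" by (rule mult_div_mod_eq)
      ultimately show ?thesis unfolding mult_Suc_right by linarith
    qed
    finally have mod: "(n0 + t + q) mod ?R = (s + t) mod ?R" by (simp only: mod_mult_self2)
    have "u (n0 + t + q) = (S ^^ K) (\<lambda>_. u ((n0 + t + q) div ?R)) (n0 + t + q)"
      by (subst (1) fixed_power[OF K(1), symmetric]) (rule subst_seq_funpow_block)
    also have "\<dots> = (S ^^ K) (\<lambda>_. u ((n0 + t + q) div ?R)) (s + t)"
      by (subst (1 2) subst_seq_funpow_const_mod[symmetric]) (simp only: mod)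
    finally show ?thesis .
  qed
  have "x (int n0 + int t) = y (int n0 + int t)" if "t < L" for t
  proof -
    have "n0 + t < 2 * ?R" using K(2) that unfolding n0_def by linarith
    then have "x (int n0 + int t) = u (n0 + t + p)" "y (int n0 + int t) = u (n0 + t + p')"
      using p(2)[of "n0 + t"] p'(2)[of "n0 + t"] by simp_all
    moreover have "u (n0 + t + p) = u (n0 + t + p')"
      unfolding u_eq[of p t, OF refl] u_eq[of p' t, OF pp'[symmetric]]
      using that by (intro K(3)[rule_format]) simp_all
    ultimately show ?thesis by simp
  qed
  then show ?thesis by blast
qed

section \<open>From agreement on long windows to injectivity of \<open>kappa\<close>\<close>

lemma translate_in_two_sided_shift: "x \<in> X \<Longrightarrow> (\<lambda>k. x (k + c)) \<in> X"
proof -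
  have "tail i (\<lambda>k. x (k + c)) = tail (i + c) x" for i by (auto simp: tail_def algebra_simps)
  then show "x \<in> X \<Longrightarrow> (\<lambda>k. x (k + c)) \<in> X" by (simp add: two_sided_shift_iff)
qed

lemma Aut_translate:
  assumes \<Phi>: "\<Phi> \<in> Aut X shift" and x: "x \<in> X"
  shows "\<Phi> (\<lambda>k. x (k + c)) = (\<lambda>k. \<Phi> x (k + c))"
proof -
  have nonneg: "\<Phi> (\<lambda>k. y (k + int n)) = (\<lambda>k. \<Phi> y (k + int n))" if "y \<in> X" for y n
    using Aut_shift_funpow[of X \<Phi> shift y n] AutD(6)[OF \<Phi>] shift_in_two_sided_shift[of _ u] that
    by (simp add: shift_funpow_int)
  show ?thesis
  proof (cases "0 \<le> c")
    case True
    then show ?thesis using nonneg[OF x, of "nat c"] by simp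
  next
    case False
    let ?y = "\<lambda>k. x (k + c)"
    \<comment> \<open>A backward translate is handled from its own side: moving \<open>?y\<close>
      forward by - c returns \<open>x\<close>.\<close>
    have "\<Phi> x = (\<lambda>k. \<Phi> ?y (k - c))"
      using nonneg[of ?y "nat (- c)"] translate_in_two_sided_shift[OF x] False by simp
    then show ?thesis by simp
  qed
qed

lemma coincidence_imp_inj_kappa:
  assumes co: "has_coincidence r \<theta>"
  shows "inj_on (kappa r X \<pi>) (Aut X shift)"
proof (rule inj_onI, rule ccontr)
  fix \<Phi> \<Psi>
  assume \<Phi>: "\<Phi> \<in> Aut X shift" and \<Psi>: "\<Psi> \<in> Aut X shift"
    and kappa: "kappa r X \<pi> \<Phi> = kappa r X \<pi> \<Psi>" and "\<Phi> \<noteq> \<Psi>"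
  then obtain x i where x: "x \<in> X" "\<Phi> x i \<noteq> \<Psi> x i"
    using extensionalityI[OF AutD(1)[OF \<Phi>] AutD(1)[OF \<Psi>]] by blast
  obtain F where F: "finite F" "\<And>y. y \<in> X \<Longrightarrow> (\<forall>j\<in>F. y j = x j) \<Longrightarrow> \<Phi> y i = \<Phi> x i"
    using continuous_on_coordinate_determined[OF AutD(2)[OF \<Phi>] x(1), of i] by blast
  obtain F' where F': "finite F'" "\<And>y. y \<in> X \<Longrightarrow> (\<forall>j\<in>F'. y j = x j) \<Longrightarrow> \<Psi> y i = \<Psi> x i"
    using continuous_on_coordinate_determined[OF AutD(2)[OF \<Psi>] x(1), of i] by blast
  obtain G where G: "\<And>y q. y \<in> X \<Longrightarrow> \<exists>p<G. \<forall>j\<in>F \<union> F'. y (q + int p + j) = x j"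
    using two_sided_minimal[OF x(1), of "F \<union> F'"] F(1) F'(1) by blast
  have "\<pi> (\<Phi> x) = \<pi> (\<Psi> x)" using kappa_spec(2)[OF \<Phi> x(1)] kappa_spec(2)[OF \<Psi> x(1)] kappa by simp
  then obtain q where q: "\<And>t. t < G + 1 \<Longrightarrow> \<Phi> x (q + int t) = \<Psi> x (q + int t)"
    using pi_eq_imp_agree_on_window[OF co AutD(5)[OF \<Phi> x(1)] AutD(5)[OF \<Psi> x(1)]] by blast
  \<comment> \<open>Searching from q - i places the recurring disagreement at coordinate q + p,
    inside the window on which the two images agree.\<close>
  obtain p where p: "p < G" "\<forall>j\<in>F \<union> F'. x (q - i + int p + j) = x j"
    using G[OF x(1), of "q - i"] by blast
  let ?c = "q - i + int p"
  let ?y = "\<lambda>k. x (k + ?c)"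
  have y: "?y \<in> X" using x(1) by (rule translate_in_two_sided_shift)
  have "\<Phi> x i = \<Phi> ?y i" using p(2) by (intro F(2)[OF y, symmetric]) (auto simp: add.commute)
  also have "\<dots> = \<Phi> x (q + int p)" by (simp add: Aut_translate[OF \<Phi> x(1)])
  also have "\<dots> = \<Psi> x (q + int p)" using p(1) by (intro q) simp
  also have "\<dots> = \<Psi> ?y i" by (simp add: Aut_translate[OF \<Psi> x(1)])
  also have "\<dots> = \<Psi> x i" using p(2) by (intro F'(2)[OF y]) (auto simp: add.commute)
  finally show False using x(2) by simp
qed

end

section \<open>The length of the substitution\<close>

lemma primitive_columns_exist:
  assumes "substitution_of_length r \<theta>" "primitive \<theta>"
  shows "\<exists>k\<ge>1. \<forall>a b. \<exists>s<r ^ k. (subst_seq r \<theta> ^^ k) (\<lambda>_. a) s = b"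
proof -
  obtain k where k: "k \<ge> 1" "\<And>a b. b \<in> set ((subst_word \<theta> ^^ k) [a])"
    using assms(2) unfolding primitive_def by blast
  have len: "\<forall>a. length (\<theta> a) = r" using assms(1) by (simp add: substitution_of_length_def)
  have "\<exists>s<r ^ k. (subst_seq r \<theta> ^^ k) (\<lambda>_. a) s = b" for a b
    using k(2)[of b a] unfolding subst_word_funpow_eq[OF len] by auto
  with k(1) show ?thesis by blast
qed

text \<open>For r at most 1 the word \<theta>^k(a) has at most one letter yet contains the whole
  alphabet. The alphabet is then a single letter and there is only one bi-infinite sequence.\<close>

lemma length_ge_2_if_infinite:
  fixes \<theta> :: "'a::{finite,discrete_topology} \<Rightarrow> 'a list"
  assumes k: "1 \<le> k" "\<forall>a b. \<exists>s<r ^ k. (subst_seq r \<theta> ^^ k) (\<lambda>_. a) s = b"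
    and inf: "infinite (X :: (int \<Rightarrow> 'a) set)"
  shows "2 \<le> r"
proof (rule ccontr)
  assume "\<not> 2 \<le> r"
  then have "r ^ k \<le> 1 ^ k" by (intro power_mono) auto
  then have R: "r ^ k \<le> 1" by simp
  have eq: "b = (subst_seq r \<theta> ^^ k) (\<lambda>_. undefined) 0" for b
  proof -
    obtain s where "s < r ^ k" "(subst_seq r \<theta> ^^ k) (\<lambda>_. undefined) s = b" using k(2) by blast
    moreover from this(1) R have "s = 0" by linarith
    ultimately show ?thesis by simp
  qed
  have "X \<subseteq> {\<lambda>_. (subst_seq r \<theta> ^^ k) (\<lambda>_. undefined) 0}"
  proof
    fix x assume "x \<in> X"
    have "x = (\<lambda>_. (subst_seq r \<theta> ^^ k) (\<lambda>_. undefined) 0)" by (rule ext) (rule eq)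
    then show "x \<in> {\<lambda>_. (subst_seq r \<theta> ^^ k) (\<lambda>_. undefined) 0}" by simp
  qed
  then show False using inf finite_subset[of X] by simp
qed

theorem theorem3p18:
  fixes \<theta> :: "'a::{finite,discrete_topology} \<Rightarrow> 'a list"
    and r :: nat
    and u :: "nat \<Rightarrow> 'a"
    and \<pi> :: "(int \<Rightarrow> 'a) \<Rightarrow> nat \<Rightarrow> nat"
  assumes "substitution_of_length r \<theta>"
    and "primitive \<theta>"
    and "periodic_point r \<theta> u"
    and "height r u = 1"
    and "infinite (two_sided_shift u)"
    and "adic_factor_map r (two_sided_shift u) shift \<pi>"
  shows "(inj_on (kappa r (two_sided_shift u) \<pi>) (Aut (two_sided_shift u) shift)
            \<longrightarrow> Aut (one_sided_shift u) shift = {restrict id (one_sided_shift u)})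
       \<and> (has_coincidence r \<theta>
            \<longrightarrow> inj_on (kappa r (two_sided_shift u) \<pi>) (Aut (two_sided_shift u) shift))"
proof -
  obtain k where k: "1 \<le> k" "\<forall>a b. \<exists>s<r ^ k. (subst_seq r \<theta> ^^ k) (\<lambda>_. a) s = b"
    using primitive_columns_exist[OF assms(1,2)] by blast
  have r: "2 \<le> r" using k assms(5) by (rule length_ge_2_if_infinite)
  obtain m where m: "1 \<le> m" "(subst_seq r \<theta> ^^ m) u = u"
    using assms(3) unfolding periodic_point_def by blast
  interpret adic_primitive_fixed_point r \<theta> u m \<pi>
  proof
    show "\<exists>k. \<forall>a b. \<exists>s<r ^ k. (subst_seq r \<theta> ^^ k) (\<lambda>_. a) s = b" using k(2) by (rule exI)
  qed (use r m assms(6) in simp_all)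
  show ?thesis
    using one_sided_Aut_trivial[OF assms(5)] coincidence_imp_inj_kappa by (intro conjI impI)
qed

end
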